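(* Let $k_1,\dots,k_r$ be positive integers, $|\boldsymbol{k}|=k_1+\cdots+k_r$, and let $m,p\ge0$ be integers. Then $$\sum_{\substack{j_1+\cdots+j_{|\boldsymbol{k}|+1}=m+1+|\boldsymbol{k}|\\ j_1,\dots,j_{|\boldsymbol{k}|+1}\ge1}}\binom{j_{|\boldsymbol{k}|+1}+p-1}{p}\;T\Big(\beta_{(k_r,k_{r-1},\dots,k_1)}(j_1,\dots,j_{|\boldsymbol{k}|}),\ \overline{j_{|\boldsymbol{k}|+1}+p}\Big)$$ $$+(-1)^{|\boldsymbol{k}|+1}\sum_{\substack{j_1+\cdots+j_{|\boldsymbol{k}|+1}=p+1+|\boldsymbol{k}|\\ j_1,\dots,j_{|\boldsymbol{k}|+1}\ge1}}\binom{j_{|\boldsymbol{k}|+1}+m-1}{m}\;T\Big(\beta_{(k_1,k_2,\dots,k_r)}(j_1,\dots,j_{|\boldsymbol{k}|}),\ \overline{j_{|\boldsymbol{k}|+1}+m}\Big)$$ $$=\sum_{l=1}^r(-1)^{k_r+k_{r-1}+\cdots+k_{l+1}}\sum_{j=1}^{k_l}(-1)^{j-1}\,T\big(P_m,k_r,k_{r-1},\dots,k_{l+1},\overline{j}\big)\;T\big(P_p,k_1,k_2,\dots,k_{l-1},\overline{k_l-j+1}\big).$$ Here $P_0$ is the empty sequence and, for $q\ge1$, $P_q=(\{1\}_{q-1},\overline{1})$, i.e. $q-1$ unbarred entries $1$ followed by $\overline{1}$; the signed sequences $\beta$ are defined in the context.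
   Context: For positive integers $k_1,\dots,k_r$ and signs $\sigma_1,\dots,\sigma_r\in\{\pm1\}$ with $(k_r,\sigma_r)\ne(1,1)$, define $$T(k_1,\dots,k_r;\sigma_1,\dots,\sigma_r):=2^r\sum_{0<n_1<\cdots<n_r}\frac{\sigma_1^{n_1}\sigma_2^{n_2}\cdots\sigma_r^{n_r}}{(2n_1-1)^{k_1}(2n_2-2)^{k_2}\cdots(2n_r-r)^{k_r}}$$ (conditionally convergent sums are limits as $N\to\infty$ of the sums over $n_r\le N$). The signs are indicated by placing a bar over $k_j$ exactly when $\sigma_j=-1$; e.g. $T(\bar2,3,\bar1)=T(2,3,1;-1,1,-1)$. Signed blocks: for positive integers $a_1,\dots,a_s$ let $\beta(a_1,\dots,a_s)$ be the signed sequence $(\overline{a_1},a_2,\dots,a_{s-1},\overline{a_s})$ if $s\ge2$ (only the first and last entries barred; for $s=2$ this is $(\overline{a_1},\overline{a_2})$), and the unbarred sequence $(a_1)$ if $s=1$. For positive integers $c_1,\dots,c_r$ and $j_1,\dots,j_{c_1+\cdots+c_r}\ge 1$, cut $(j_1,\dots,j_{c_1+\cdots+c_r})$ into consecutive blocks of lengths $c_1,c_2,\dots,c_r$, apply $\beta$ to each block, and concatenate; the result is denoted $\beta_{(c_1,\dots,c_r)}(j_1,\dots,j_{c_1+\cdots+c_r})$. *)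

theory Defs
  imports Complex_Main
begin

text \<open>
  A signed sequence is a list of pairs (k, \<sigma>) with k a positive integer and \<sigma> = 1 or -1;
  a bar over k means \<sigma> = -1.
\<close>

type_synonym signed_seq = "(nat \<times> int) list"

definition plain :: "nat \<Rightarrow> nat \<times> int" where
  "plain k = (k, 1)"

definition bar :: "nat \<Rightarrow> nat \<times> int" where
  "bar k = (k, -1)"

text \<open>
  List positions start at 0, so entry i of the list is the one with number i + 1 in
  k_1, ..., k_r; its denominator is (2 n_{i+1} - (i + 1))^{k_{i+1}}, which is
  positive because n_{i+1} \<ge> i + 1.
\<close>

definition T_partial :: "signed_seq \<Rightarrow> nat \<Rightarrow> real" where
  "T_partial s N = 2 ^ length s *
     (\<Sum>n | length n = length s \<and> sorted_wrt (<) n \<and> set n \<subseteq> {1..N}.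
        \<Prod>i<length s. of_int (snd (s ! i)) ^ (n ! i)
                      / (2 * real (n ! i) - real (i + 1)) ^ fst (s ! i))"

text \<open>
  Meaningful for nonempty sequences whose last entry is not an unbarred 1; these are the
  sequences for which the partial sums converge.
\<close>

definition T :: "signed_seq \<Rightarrow> real" where
  "T s = lim (\<lambda>N. T_partial s N)"

fun beta :: "nat list \<Rightarrow> signed_seq" where
  "beta [] = []"
| "beta [a] = [plain a]"
| "beta (a # b # as) = bar a # map plain (butlast (b # as)) @ [bar (last (b # as))]"

fun beta_blocks :: "nat list \<Rightarrow> nat list \<Rightarrow> signed_seq" where
  "beta_blocks [] js = []"
| "beta_blocks (c # cs) js = beta (take c js) @ beta_blocks cs (drop c js)"

definition P :: "nat \<Rightarrow> signed_seq" where
  "P q = (if q = 0 then [] else replicate (q - 1) (plain 1) @ [bar 1])"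

definition compositions :: "nat \<Rightarrow> nat \<Rightarrow> nat list set" where
  "compositions w d = {js. length js = d \<and> (\<forall>j\<in>set js. 1 \<le> j) \<and> sum_list js = w}"

end

theory Submission
  imports Defs "HOL-Analysis.Summation_Tests"
begin

text \<open>
  The values \<open>T\<close> are iterated integrals over \<open>(0, 1)\<close> in the forms \<open>dt/t\<close>, \<open>2 dt/(1 - t\<^sup>2)\<close> and
  \<open>2 dt/(1 + t\<^sup>2)\<close>: a denominator \<open>n\<^sup>k\<close> contributes \<open>k - 1\<close> factors \<open>dt/t\<close>, preceded by one of the
  other two forms according to the product of the signs of that entry and of all later ones
  (\<open>endvalue_T\<close>, by comparing power series coefficients and applying Abel's theorem).

  Let \<open>W\<close> be the word that consists of one block \<open>Arctan Log ... Log\<close> of length \<open>k\<close> for each entry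
  \<open>k\<close> of \<open>ks\<close>, followed by a final \<open>Arctan\<close>. A cut of \<open>W\<close> into a nonempty prefix and a nonempty
  suffix gives the function \<open>F\<close> that integrates \<open>p\<close> forms \<open>Artanh\<close> and then the prefix, and the
  function \<open>G\<close> that integrates \<open>m\<close> forms \<open>Artanh\<close> and then the suffix read backwards. The \<open>K\<close>
  cuts are exactly the pairs \<open>(l, j)\<close> on the right hand side, and the product of the values of
  \<open>F\<close> and \<open>G\<close> at 1 is, up to sign, the product of the two \<open>T\<close>-values there. In the alternating
  sum of \<open>F G\<close> over all cuts, differentiation removes one letter next to the cut, from one side
  or the other; neighbouring cuts cancel, and only the derivatives at the two ends of \<open>W\<close> remain
  (\<open>alternating_cuts_eq\<close>).

  Each remaining term is \<open>2 dt/(1 + t\<^sup>2)\<close> times an iterated integral times a power of the logarithm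
  \<open>\<integral> 2 dt/(1 - t\<^sup>2)\<close>. Multiplication by that power shuffles the form \<open>Artanh\<close> into the word in
  all possible ways. The positions are recorded by the composition \<open>js\<close>, and the binomial
  coefficient counts the ways to mix with the \<open>Artanh\<close> forms that stood at the inner end already
  (\<open>shuffle_sum_eq\<close>). Finally the substitution \<open>t \<mapsto> (1 - t)/(1 + t)\<close> reverses a word and
  exchanges \<open>dt/t\<close> with \<open>2 dt/(1 - t\<^sup>2)\<close> (\<open>endvalue_dual\<close>). It turns the shuffled words into the
  words of the sequences built from the signed blocks (\<open>endvalue_weave\<close>), which gives the left
  hand side.

  All integrals are treated as power series, and each identity between functions is obtained by
  comparing derivatives on \<open>(0, 1)\<close> and values at 0.
\<close>

section \<open>Abel's limit theorem\<close>

lemma summable_bounded_power: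
  fixes c :: "nat \<Rightarrow> real"
  assumes "\<And>n. \<bar>c n\<bar> \<le> M" and "\<bar>x\<bar> < 1"
  shows "summable (\<lambda>n. \<bar>c n * x ^ n\<bar>)"
proof (rule summable_comparison_test')
  show "summable (\<lambda>n. M * \<bar>x\<bar> ^ n)"
    using assms(2) by (intro summable_mult summable_geometric) auto
  show "norm \<bar>c n * x ^ n\<bar> \<le> M * \<bar>x\<bar> ^ n" for n
    using assms(1)[of n] by (simp add: abs_mult power_abs mult_right_mono)
qed

text \<open>
  The weights \<open>(1 - x) x\<^sup>n\<close> have total mass 1 and escape to infinity as \<open>x\<close> tends to 1, so they
  average a null sequence to 0.
\<close>

lemma tendsto_weighted_power_series_0:
  fixes d :: "nat \<Rightarrow> real"
  assumes d: "d \<longlonglongrightarrow> 0"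
  shows "((\<lambda>x. (1 - x) * (\<Sum>n. d n * x ^ n)) \<longlongrightarrow> 0) (at_left 1)"
proof -
  obtain M where M: "\<And>n. \<bar>d n\<bar> \<le> M"
    using d convergent_imp_Bseq[of d] by (auto simp: convergent_def Bseq_def)
  show ?thesis
  proof (rule tendstoI)
    fix e :: real
    assume e: "e > 0"
    obtain N where N: "\<And>n. n \<ge> N \<Longrightarrow> \<bar>d n\<bar> \<le> e / 2"
      using d e by (auto simp: LIMSEQ_iff dest!: spec[of _ "e/2"]) (meson less_imp_le)
    define B where "B = (\<Sum>n<N. \<bar>d n\<bar>)"
    have B: "B \<ge> 0"
      by (simp add: B_def sum_nonneg)
    have key: "\<bar>(1 - x) * (\<Sum>n. d n * x ^ n)\<bar> \<le> (1 - x) * B + e / 2" if x: "0 < x" "x < 1" for x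
    proof -
      have abs: "summable (\<lambda>n. \<bar>d n * x ^ n\<bar>)"
        by (rule summable_bounded_power[OF M]) (use x in auto)
      have "\<bar>\<Sum>n. d n * x ^ n\<bar> \<le> (\<Sum>n. \<bar>d n * x ^ n\<bar>)"
        using summable_norm[of "\<lambda>n. d n * x ^ n"] abs by simp
      also have "\<dots> = (\<Sum>n. \<bar>d (n + N) * x ^ (n + N)\<bar>) + (\<Sum>n<N. \<bar>d n * x ^ n\<bar>)"
        by (rule suminf_split_initial_segment[OF abs])
      also have "(\<Sum>n<N. \<bar>d n * x ^ n\<bar>) \<le> B"
        unfolding B_def using x by (intro sum_mono) (simp add: abs_mult power_le_one mult_left_le)
      also have "(\<Sum>n. \<bar>d (n + N) * x ^ (n + N)\<bar>) \<le> (\<Sum>n. e / 2 * x ^ n)"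
      proof (rule suminf_le)
        show "\<bar>d (n + N) * x ^ (n + N)\<bar> \<le> e / 2 * x ^ n" for n
        proof -
          have "x ^ (n + N) \<le> x ^ n"
            using x by (intro power_decreasing) auto
          then show ?thesis
            using N[of "n + N"] x e unfolding abs_mult by (intro mult_mono) (auto simp del: power_add)
        qed
        show "summable (\<lambda>n. \<bar>d (n + N) * x ^ (n + N)\<bar>)"
          using summable_ignore_initial_segment[OF abs, of N] .
        show "summable (\<lambda>n. e / 2 * x ^ n)"
          using x by (intro summable_mult summable_geometric) auto
      qed
      also have "(\<Sum>n. e / 2 * x ^ n) = e / 2 / (1 - x)"
        using x by (subst suminf_mult) (auto simp: suminf_geometric summable_geometric)
      finally have "\<bar>\<Sum>n. d n * x ^ n\<bar> \<le> e / 2 / (1 - x) + B"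
        by simp
      then have "(1 - x) * \<bar>\<Sum>n. d n * x ^ n\<bar> \<le> (1 - x) * (e / 2 / (1 - x) + B)"
        using x by (intro mult_left_mono) auto
      also have "\<dots> = (1 - x) * B + e / 2"
        using x by (simp add: field_simps)
      finally show ?thesis
        using x by (simp add: abs_mult)
    qed
    have "((\<lambda>x. (1 - x) * B + e / 2) \<longlongrightarrow> (1 - 1) * B + e / 2) (at_left 1)"
      by (intro tendsto_intros)
    then have "\<forall>\<^sub>F x in at_left 1. (1 - x) * B + e / 2 < e"
      by (rule order_tendstoD(2)) (use e in auto)
    moreover have "\<forall>\<^sub>F x in at_left 1. 0 < x \<and> x < (1::real)"
      using eventually_at_left_real[of 0 1] by simp
    ultimately show "\<forall>\<^sub>F x in at_left 1. dist ((1 - x) * (\<Sum>n. d n * x ^ n)) 0 < e"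
      by eventually_elim (use key in \<open>fastforce simp: dist_real_def\<close>)
  qed
qed

text \<open>
  Summation by parts, in the form of a Cauchy product with the geometric series, expresses the
  error as the weighted average of the tails of the series.
\<close>

theorem abel_limit:
  fixes a :: "nat \<Rightarrow> real"
  assumes a: "a sums S"
  shows "((\<lambda>x. \<Sum>n. a n * x ^ n) \<longlongrightarrow> S) (at_left 1)"
proof -
  define d where "d = (\<lambda>n. (\<Sum>k\<le>n. a k) - S)"
  have d: "d \<longlonglongrightarrow> 0"
    using a unfolding d_def sums_def_le by (simp add: LIM_zero)
  obtain M where M: "\<And>n. \<bar>a n\<bar> \<le> M"
    using summable_LIMSEQ_zero[OF sums_summable[OF a]] convergent_imp_Bseq[of a]
    by (auto simp: convergent_def Bseq_def)
  obtain D where D: "\<And>n. \<bar>d n\<bar> \<le> D"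
    using d convergent_imp_Bseq[of d] by (auto simp: convergent_def Bseq_def)
  have eq: "(\<Sum>n. a n * x ^ n) = S + (1 - x) * (\<Sum>n. d n * x ^ n)" if x: "0 < x" "x < 1" for x
  proof -
    have "(\<lambda>k. \<Sum>i\<le>k. (a i * x ^ i) * (1 * x ^ (k - i))) sums ((\<Sum>k. a k * x ^ k) * (\<Sum>k. 1 * x ^ k))"
      using summable_bounded_power[of a M x, OF M] summable_bounded_power[of "\<lambda>_. 1" 1 x] x
      by (intro Cauchy_product_sums) auto
    moreover have "(\<Sum>i\<le>k. (a i * x ^ i) * (1 * x ^ (k - i))) = d k * x ^ k + S * x ^ k" for k
    proof -
      have "(\<Sum>i\<le>k. (a i * x ^ i) * (1 * x ^ (k - i))) = (\<Sum>i\<le>k. a i * x ^ k)"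
        by (intro sum.cong) (auto simp flip: power_add)
      then show ?thesis
        by (simp add: d_def left_diff_distrib flip: sum_distrib_right)
    qed
    ultimately have 1: "(\<lambda>k. d k * x ^ k + S * x ^ k) sums ((\<Sum>k. a k * x ^ k) * (1 / (1 - x)))"
      using x by (simp add: suminf_geometric)
    have "(\<lambda>k. d k * x ^ k) sums (\<Sum>k. d k * x ^ k)"
      using summable_bounded_power[of d D x, OF D] x by (intro summable_sums) (auto intro: summable_rabs_cancel)
    moreover have "(\<lambda>k. S * x ^ k) sums (S * (1 / (1 - x)))"
      using x by (intro sums_mult geometric_sums) auto
    ultimately have "(\<lambda>k. d k * x ^ k + S * x ^ k) sums ((\<Sum>k. d k * x ^ k) + S * (1 / (1 - x)))"
      by (rule sums_add)
    from sums_unique2[OF 1 this] show ?thesis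
      using x by (simp add: field_simps)
  qed
  have "((\<lambda>x. S + (1 - x) * (\<Sum>n. d n * x ^ n)) \<longlongrightarrow> S + 0) (at_left 1)"
    by (intro tendsto_intros tendsto_weighted_power_series_0 d)
  moreover have "\<forall>\<^sub>F x in at_left 1. S + (1 - x) * (\<Sum>n. d n * x ^ n) = (\<Sum>n. a n * x ^ n)"
    using eventually_at_left_real[of 0 1, simplified] by eventually_elim (use eq in auto)
  ultimately show ?thesis
    using tendsto_cong by (force simp: eq)
qed

section \<open>Iterated integrals as power series\<close>

text \<open>
  The differential forms \<open>dt/t\<close>, \<open>2 dt/(1 - t\<^sup>2)\<close> and \<open>2 dt/(1 + t\<^sup>2)\<close>, named after their
  primitives (up to the factor 2 for the last two).
\<close>

datatype form = Log | Artanh | Arctan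

text \<open>
  For the last two forms this is the \<open>\<epsilon>\<close> in \<open>2 dt/(1 - \<epsilon> t\<^sup>2)\<close>. The value at \<open>Log\<close> is chosen so
  that the product over a word is \<open>-1\<close> to the number of \<open>Arctan\<close> forms.
\<close>

fun sgn_form :: "form \<Rightarrow> real" where
  "sgn_form Arctan = -1"
| "sgn_form _ = 1"

fun density :: "form \<Rightarrow> real \<Rightarrow> real" where
  "density Log t = 1 / t"
| "density Artanh t = 2 / (1 - t ^ 2)"
| "density Arctan t = 2 / (1 + t ^ 2)"

text \<open>
  The Taylor coefficients of \<open>density a\<close> at 0, for \<open>a \<noteq> Log\<close>.
\<close>

definition density_coeff :: "form \<Rightarrow> nat \<Rightarrow> real" where
  "density_coeff a n = (if even n then 2 * sgn_form a ^ (n div 2) else 0)"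

text \<open>
  Words are written with the outermost form, the one integrated last, at the head. Integration
  divides the coefficient of \<open>x\<^sup>n\<close> by \<open>n\<close>, after a Cauchy product with the density; for \<open>dt/t\<close> the
  two shifts of the exponent cancel. A word whose innermost form is \<open>Log\<close> is a divergent integral,
  to which division by 0 gives the value 0; the differential equation below excludes such words.
\<close>

fun coeff :: "form list \<Rightarrow> nat \<Rightarrow> real" where
  "coeff [] n = (if n = 0 then 1 else 0)"
| "coeff (a # w) n =
     (if a = Log then coeff w n else \<Sum>q<n. coeff w q * density_coeff a (n - 1 - q)) / real n"

definition hyperlog :: "form list \<Rightarrow> real \<Rightarrow> real" where
  "hyperlog w x = (\<Sum>n. coeff w n * x ^ n)"

lemma abs_density_coeff_le: "\<bar>density_coeff a n\<bar> \<le> 2"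
  by (cases a) (auto simp: density_coeff_def abs_mult power_abs)

lemma abs_coeff_le: "\<bar>coeff w n\<bar> \<le> 2 ^ length w"
proof (induction w arbitrary: n)
  case (Cons a w)
  show ?case
  proof (cases "n = 0")
    case False
    have "\<bar>if a = Log then coeff w n else \<Sum>q<n. coeff w q * density_coeff a (n - 1 - q)\<bar> \<le> real n * 2 ^ length (a # w)"
    proof (cases "a = Log")
      case True
      have "\<bar>coeff w n\<bar> \<le> 1 * 2 ^ length w"
        using Cons by simp
      also have "\<dots> \<le> real n * 2 ^ length (a # w)"
        using False by (intro mult_mono) auto
      finally show ?thesis
        using True by simp
    next
      case a: False
      have "\<bar>\<Sum>q<n. coeff w q * density_coeff a (n - 1 - q)\<bar> \<le> (\<Sum>q<n. 2 ^ length w * 2)"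
        by (rule order.trans[OF sum_abs], rule sum_mono)
           (auto simp: abs_mult intro!: mult_mono abs_density_coeff_le Cons)
      then show ?thesis
        using a by simp
    qed
    then show ?thesis
      using False by (simp add: field_simps)
  qed auto
qed auto

lemma summable_abs_hyperlog: "\<bar>x\<bar> < 1 \<Longrightarrow> summable (\<lambda>n. \<bar>coeff w n * x ^ n\<bar>)"
  by (rule summable_bounded_power[OF abs_coeff_le])

lemma summable_hyperlog: "\<bar>x\<bar> < 1 \<Longrightarrow> summable (\<lambda>n. coeff w n * x ^ n)"
  by (rule summable_rabs_cancel[OF summable_abs_hyperlog])

lemma density_power_series:
  assumes "a \<noteq> Log" "\<bar>x\<bar> < 1"
  shows "(\<lambda>n. density_coeff a n * x ^ n) sums density a x"
proof -
  have "x ^ 2 < 1"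
    using assms(2) by (simp add: abs_square_less_1)
  then have "\<bar>sgn_form a * x ^ 2\<bar> < 1"
    by (cases a) auto
  then have "(\<lambda>n. (sgn_form a * x ^ 2) ^ n) sums (1 / (1 - sgn_form a * x ^ 2))"
    by (intro geometric_sums) auto
  then have "(\<lambda>n. 2 * (sgn_form a * x ^ 2) ^ n) sums (2 * (1 / (1 - sgn_form a * x ^ 2)))"
    by (rule sums_mult)
  also have "2 * (1 / (1 - sgn_form a * x ^ 2)) = density a x"
    using assms by (cases a) auto
  also have "(\<lambda>n. 2 * (sgn_form a * x ^ 2) ^ n) = (\<lambda>n. density_coeff a (2 * n) * x ^ (2 * n))"
    by (auto simp: density_coeff_def power_mult_distrib power_mult mult.assoc)
  finally show ?thesis
    by (subst (asm) sums_mono_reindex) (auto simp: strict_mono_def density_coeff_def elim!: evenE)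
qed

lemma hyperlog_Nil [simp]: "hyperlog [] x = 1"
  unfolding hyperlog_def by (subst suminf_finite[of "{0}"]) auto

lemma hyperlog_Cons_0 [simp]: "hyperlog (a # w) 0 = 0"
  by (simp add: hyperlog_def powser_zero del: coeff.simps(2)) simp

lemma isCont_hyperlog: "\<bar>x\<bar> < 1 \<Longrightarrow> isCont (hyperlog w) x"
  unfolding hyperlog_def
  by (rule DERIV_isCont, rule termdiffs_strong'[where K = 1]) (auto intro: summable_hyperlog)

lemma continuous_on_hyperlog: "x < 1 \<Longrightarrow> continuous_on {0..x} (hyperlog w)"
  by (intro continuous_at_imp_continuous_on) (auto intro!: isCont_hyperlog)

text \<open>
  The fundamental theorem of calculus for the iterated integral. From here on this equation,
  together with the value at 0, replaces the coefficients, except in the comparison with the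
  sums \<open>T\<close>.
\<close>

lemma DERIV_hyperlog:
  assumes x: "0 < x" "x < 1" and w: "last (a # w) \<noteq> Log"
  shows "(hyperlog (a # w) has_real_derivative density a x * hyperlog w x) (at x)"
proof -
  have "(hyperlog (a # w) has_real_derivative (\<Sum>n. diffs (coeff (a # w)) n * x ^ n)) (at x)"
    unfolding hyperlog_def using x
    by (intro termdiffs_strong'[where K = 1]) (auto intro: summable_hyperlog simp del: coeff.simps)
  also have "(\<Sum>n. diffs (coeff (a # w)) n * x ^ n) = density a x * hyperlog w x"
  proof (cases "a = Log")
    case True
    then have "w \<noteq> []"
      using w by auto
    then have 0: "coeff w 0 = 0"
      by (cases w) auto
    have s: "(\<lambda>n. coeff w n * x ^ n) sums hyperlog w x"
      unfolding hyperlog_def using summable_hyperlog[of x w] x by (simp add: summable_sums)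
    then have "(\<lambda>n. coeff w (Suc n) * x ^ Suc n) sums hyperlog w x"
      using 0 by (subst sums_Suc_iff) simp
    then have "(\<lambda>n. coeff w (Suc n) * x ^ Suc n / x) sums (hyperlog w x / x)"
      by (rule sums_divide)
    also have "(\<lambda>n. coeff w (Suc n) * x ^ Suc n / x) = (\<lambda>n. diffs (coeff (a # w)) n * x ^ n)"
      using x True by (auto simp: diffs_def field_simps)
    finally show ?thesis
      using True by (simp add: sums_iff)
  next
    case False
    have "(\<lambda>k. \<Sum>i\<le>k. (coeff w i * x ^ i) * (density_coeff a (k - i) * x ^ (k - i))) sums
        ((\<Sum>k. coeff w k * x ^ k) * (\<Sum>k. density_coeff a k * x ^ k))"
      using summable_abs_hyperlog[of x w] summable_bounded_power[of "density_coeff a" 2 x] x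
      by (intro Cauchy_product_sums) (auto simp: abs_density_coeff_le)
    also have "(\<lambda>k. \<Sum>i\<le>k. (coeff w i * x ^ i) * (density_coeff a (k - i) * x ^ (k - i)))
        = (\<lambda>k. diffs (coeff (a # w)) k * x ^ k)"
    proof
      fix k
      have "(\<Sum>i\<le>k. (coeff w i * x ^ i) * (density_coeff a (k - i) * x ^ (k - i)))
          = (\<Sum>i\<le>k. coeff w i * density_coeff a (k - i) * x ^ k)"
        by (intro sum.cong) (auto simp flip: power_add)
      also have "\<dots> = diffs (coeff (a # w)) k * x ^ k"
        using False by (simp add: diffs_def sum_distrib_right lessThan_Suc_atMost del: of_nat_Suc)
      finally show "(\<Sum>i\<le>k. (coeff w i * x ^ i) * (density_coeff a (k - i) * x ^ (k - i)))
        = diffs (coeff (a # w)) k * x ^ k" .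
    qed
    also have "(\<Sum>k. density_coeff a k * x ^ k) = density a x"
      using density_power_series[OF False, of x] x by (simp add: sums_iff)
    finally show ?thesis
      by (simp add: sums_iff hyperlog_def mult.commute del: coeff.simps)
  qed
  finally show ?thesis .
qed

lemma eq_if_DERIV_eq:
  fixes f g :: "real \<Rightarrow> real"
  assumes "0 \<le> x" "x < 1" and "f 0 = g 0"
    and cont: "\<And>y. y < 1 \<Longrightarrow> continuous_on {0..y} f" "\<And>y. y < 1 \<Longrightarrow> continuous_on {0..y} g"
    and "\<And>y. 0 < y \<Longrightarrow> y < 1 \<Longrightarrow> (f has_real_derivative h y) (at y)"
    and "\<And>y. 0 < y \<Longrightarrow> y < 1 \<Longrightarrow> (g has_real_derivative h y) (at y)"
  shows "f x = g x"
proof (cases "x = 0")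
  case False
  have "(f x - g x) = (f 0 - g 0)"
  proof (rule DERIV_isconst2[where f = "\<lambda>x. f x - g x" and b = x])
    show "continuous_on {0..x} (\<lambda>x. f x - g x)"
      using cont[OF assms(2)] by (rule continuous_on_diff)
    show "((\<lambda>x. f x - g x) has_real_derivative 0) (at y)" if "0 < y" "y < x" for y
      using DERIV_diff[OF assms(6,7)[of y]] that assms(2) by simp
  qed (use False assms in auto)
  then show ?thesis
    using assms(3) by simp
qed (use assms in simp)

text \<open>
  The true growth at 1 is a power of \<open>ln (1 / (1 - x))\<close>; the factor \<open>1 / sqrt (1 - x)\<close> dominates
  all of these and reproduces itself under integration, as \<open>x / sqrt (1 - x)\<close> has a
  derivative of at least \<open>1/2\<close> times \<open>(1 - x)\<close> to the power \<open>-3/2\<close>. The factor \<open>x\<close> serves to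
  absorb the pole of \<open>dt/t\<close>.
\<close>

lemma abs_hyperlog_le:
  assumes "w \<noteq> []" "last w \<noteq> Log" "0 \<le> x" "x < 1"
  shows "\<bar>hyperlog w x\<bar> \<le> 4 ^ length w * (x / sqrt (1 - x))"
  using assms
proof (induction w arbitrary: x)
  case (Cons a w)
  define C :: real where "C = 4 ^ length (a # w)"
  define g where "g = (\<lambda>t::real. t / sqrt (1 - t))"
  define g' where "g' = (\<lambda>t::real. (1 - t / 2) / ((1 - t) * sqrt (1 - t)))"
  have g: "(g has_real_derivative g' t) (at t)" if "0 < t" "t < 1" for t
    unfolding g_def g'_def using that
    by (auto intro!: derivative_eq_intros simp: divide_simps) (simp add: algebra_simps)
  have contg: "continuous_on {0..x} g"
    unfolding g_def using Cons.prems by (intro continuous_intros) auto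
  have f: "(hyperlog (a # w) has_real_derivative density a t * hyperlog w t) (at t)" if "0 < t" "t < 1" for t
    using DERIV_hyperlog[of t a w] that Cons.prems by simp
  have contf: "continuous_on {0..x} (hyperlog (a # w))"
    using Cons.prems by (intro continuous_on_hyperlog) auto
  have le: "\<bar>density a t * hyperlog w t\<bar> \<le> C * g' t" if t: "0 < t" "t < 1" for t
  proof -
    have sq: "0 < sqrt (1 - t)" "sqrt (1 - t) \<le> 1"
      using t by auto
    have g'_ge: "1 / ((1 - t) * sqrt (1 - t)) \<le> 2 * g' t"
    proof -
      have "1 / ((1 - t) * sqrt (1 - t)) \<le> (2 * (1 - t / 2)) / ((1 - t) * sqrt (1 - t))"
        using t sq by (intro divide_right_mono) auto
      then show ?thesis
        by (simp add: g'_def)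
    qed
    have dens: "\<bar>density a t\<bar> \<le> 2 / (1 - t)" if "a \<noteq> Log"
    proof (cases a)
      case Artanh
      have "t ^ 2 \<le> t" using t by (simp add: power2_eq_square mult_left_le)
      moreover have "t ^ 2 < 1"  using t by (simp add: power_less_one_iff)
      ultimately show ?thesis
        using t Artanh by (auto simp: abs_mult frac_le)
    next
      case Arctan
      have "1 - t \<le> 1 + t ^ 2"
        using t zero_le_power2[of t] by linarith
      then have "2 / (1 + t ^ 2) \<le> 2 / (1 - t)"
        using t by (intro frac_le) auto
      then show ?thesis
        using Arctan by simp
    qed (use that in simp)
    show ?thesis
    proof (cases "w = []")
      case True
      then have "\<bar>density a t * hyperlog w t\<bar> \<le> 2 / (1 - t)"
        using dens Cons.prems by simp
      also have "\<dots> \<le> 2 * (1 / ((1 - t) * sqrt (1 - t)))"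
        using t sq frac_le[of 2 2 "(1 - t) * sqrt (1 - t)" "1 - t"] by (simp add: mult_left_le)
      also have "\<dots> \<le> 2 * (2 * g' t)"
        using g'_ge by (intro mult_left_mono) auto
      also have "\<dots> = C * g' t"
        using True by (simp add: C_def)
      finally show ?thesis .
    next
      case False
      define D :: real where "D = 4 ^ length w"
      have D: "D > 0" "C = 4 * D"
        by (simp_all add: D_def C_def)
      have IH: "\<bar>hyperlog w t\<bar> \<le> D * (t / sqrt (1 - t))"
        unfolding D_def using Cons.IH[of t] False Cons.prems t by simp
      have "\<bar>density a t\<bar> * t \<le> 2 / (1 - t)"
      proof (cases "a = Log")
        case True
        then show ?thesis
          using t by (simp add: field_simps)
      next
        case False
        have "\<bar>density a t\<bar> * t \<le> \<bar>density a t\<bar> * 1"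
          using t by (intro mult_left_mono) auto
        then show ?thesis
          using dens[OF False] by simp
      qed
      then have "\<bar>density a t\<bar> * t * (D / sqrt (1 - t)) \<le> 2 / (1 - t) * (D / sqrt (1 - t))"
        using D sq by (intro mult_right_mono) auto
      also have "\<dots> = 2 * D * (1 / ((1 - t) * sqrt (1 - t)))"
        by simp
      also have "\<dots> \<le> 2 * D * (2 * g' t)"
        using g'_ge D by (intro mult_left_mono) auto
      finally have "\<bar>density a t\<bar> * (D * (t / sqrt (1 - t))) \<le> C * g' t"
        by (simp add: D mult_ac)
      moreover have "\<bar>density a t * hyperlog w t\<bar> \<le> \<bar>density a t\<bar> * (D * (t / sqrt (1 - t)))"
        unfolding abs_mult by (intro mult_left_mono IH) auto
      ultimately show ?thesis
        by linarith
    qed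
  qed
  have "C * g 0 - hyperlog (a # w) 0 \<le> C * g x - hyperlog (a # w) x"
  proof (rule DERIV_nonneg_imp_increasing_open[where f = "\<lambda>t. C * g t - hyperlog (a # w) t"])
    show "\<exists>y. ((\<lambda>t. C * g t - hyperlog (a # w) t) has_real_derivative y) (at t) \<and> 0 \<le> y"
      if t: "0 < t" "t < x" for t
    proof (intro exI conjI)
      show "((\<lambda>t. C * g t - hyperlog (a # w) t) has_real_derivative
              C * g' t - density a t * hyperlog w t) (at t)"
        using that Cons.prems by (intro DERIV_diff DERIV_cmult f g) auto
      show "0 \<le> C * g' t - density a t * hyperlog w t"
        using le[of t] that Cons.prems by linarith
    qed
  qed (use Cons.prems contf contg in \<open>auto intro!: continuous_intros\<close>)
  moreover have "C * g 0 + hyperlog (a # w) 0 \<le> C * g x + hyperlog (a # w) x"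
  proof (rule DERIV_nonneg_imp_increasing_open[where f = "\<lambda>t. C * g t + hyperlog (a # w) t"])
    show "\<exists>y. ((\<lambda>t. C * g t + hyperlog (a # w) t) has_real_derivative y) (at t) \<and> 0 \<le> y"
      if t: "0 < t" "t < x" for t
    proof (intro exI conjI)
      show "((\<lambda>t. C * g t + hyperlog (a # w) t) has_real_derivative
              C * g' t + density a t * hyperlog w t) (at t)"
        using that Cons.prems by (intro DERIV_add DERIV_cmult f g) auto
      show "0 \<le> C * g' t + density a t * hyperlog w t"
        using le[of t] that Cons.prems by linarith
    qed
  qed (use Cons.prems contf contg in \<open>auto intro!: continuous_intros\<close>)
  moreover have "g 0 = 0"
    by (simp add: g_def)
  ultimately have "\<bar>hyperlog (a # w) x\<bar> \<le> C * g x"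
    by simp
  then show ?case
    by (simp only: C_def g_def)
qed simp

section \<open>Growth and convergence of the partial sums\<close>

definition index_lists :: "nat \<Rightarrow> nat \<Rightarrow> nat list set" where
  "index_lists L N = {n. length n = L \<and> sorted_wrt (<) n \<and> set n \<subseteq> {1..N}}"

lemma finite_index_lists: "finite (index_lists L N)"
  by (rule finite_subset[OF _ finite_lists_length_eq[of "{1..N}" L]]) (auto simp: index_lists_def)

lemma T_partial_Nil [simp]: "T_partial [] N = 1"
proof -
  have "{n. length n = 0 \<and> sorted_wrt (<) n \<and> set n \<subseteq> {1..N}} = {[] :: nat list}"
    by auto
  then show ?thesis
    by (simp add: T_partial_def)
qed

text \<open>
  Splitting off the largest summation index.
\<close>

lemma T_partial_snoc:
  "T_partial (s @ [(k, \<sigma>)]) N =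
     (\<Sum>n = 1..N. 2 * of_int \<sigma> ^ n / (2 * real n - real (length s + 1)) ^ k * T_partial s (n - 1))"
proof -
  define L where "L = length s"
  define g where "g = (\<lambda>n. of_int \<sigma> ^ n / (2 * real n - real (L + 1)) ^ k :: real)"
  define f where "f = (\<lambda>l :: nat list. \<Prod>i<L. of_int (snd (s ! i)) ^ (l ! i) / (2 * real (l ! i) - real (i + 1)) ^ fst (s ! i) :: real)"
  have TP: "T_partial s N = 2 ^ L * (\<Sum>l\<in>index_lists L N. f l)" for N
    by (simp add: T_partial_def index_lists_def L_def f_def)
  have "T_partial (s @ [(k, \<sigma>)]) N = 2 ^ Suc L * (\<Sum>l\<in>index_lists (Suc L) N. f l * g (l ! L))"
    unfolding T_partial_def index_lists_def
    by (simp add: L_def f_def g_def nth_append)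
  also have "(\<Sum>l\<in>index_lists (Suc L) N. f l * g (l ! L))
      = (\<Sum>(n, l)\<in>(SIGMA n:{1..N}. index_lists L (n - 1)). f l * g n)"
  proof (rule sum.reindex_bij_witness[where i = "\<lambda>(n, l). l @ [n]" and j = "\<lambda>l. (last l, butlast l)"])
    fix l assume l: "l \<in> index_lists (Suc L) N"
    then have ne: "l \<noteq> []"
      by (auto simp: index_lists_def)
    then obtain l' x where l': "l = l' @ [x]"
      by (metis append_butlast_last_id)
    show "(case (last l, butlast l) of (n, l) \<Rightarrow> l @ [n]) = l"
      using ne by simp
    show "(last l, butlast l) \<in> (SIGMA n:{1..N}. index_lists L (n - 1))"
      using l by (force simp: l' index_lists_def sorted_wrt_append)
    have "length l' = L"
      using l by (simp add: l' index_lists_def)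
    then show "(case (last l, butlast l) of (n, l) \<Rightarrow> f l * g n) = f l * g (l ! L)"
      by (auto simp: l' f_def nth_append intro!: prod.cong)
  next
    fix b assume "b \<in> (SIGMA n:{1..N}. index_lists L (n - 1))"
    then show "(last (case b of (n, l) \<Rightarrow> l @ [n]), butlast (case b of (n, l) \<Rightarrow> l @ [n])) = b"
      "(case b of (n, l) \<Rightarrow> l @ [n]) \<in> index_lists (Suc L) N"
      by (force simp: index_lists_def sorted_wrt_append)+
  qed
  also have "\<dots> = (\<Sum>n = 1..N. \<Sum>l\<in>index_lists L (n - 1). f l * g n)"
    by (subst sum.Sigma) (auto simp: finite_index_lists)
  also have "2 ^ Suc L * \<dots> = (\<Sum>n = 1..N. 2 * g n * T_partial s (n - 1))"
    unfolding TP sum_distrib_left by (intro sum.cong) (auto simp: mult_ac)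
  finally show ?thesis
    by (simp add: g_def L_def)
qed

text \<open>
  No strictly increasing list with entries up to \<open>N\<close> has that length. This also disposes of the indices for
  which a denominator \<open>2 n - r\<close> would not be positive.
\<close>

lemma T_partial_eq_0:
  assumes "N < length s"
  shows "T_partial s N = 0"
proof -
  have "index_lists (length s) N = {}"
  proof -
    have "length l \<le> N" if "sorted_wrt (<) l" "set l \<subseteq> {1..N}" for l :: "nat list"
    proof -
      have "distinct l"
        using that(1) strict_sorted_iff by auto
      then have "length l = card (set l)"
        by (simp add: distinct_card)
      also have "\<dots> \<le> N"
        using card_mono[OF _ that(2)] by simp
      finally show ?thesis .
    qed
    then show ?thesis
      using assms by (fastforce simp: index_lists_def)
  qed
  then show ?thesis
    unfolding T_partial_def index_lists_def by (simp only: sum.empty mult_zero_right)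
qed

definition valid_seq :: "signed_seq \<Rightarrow> bool" where
  "valid_seq s \<longleftrightarrow> (\<forall>(k, \<sigma>)\<in>set s. 1 \<le> k \<and> \<bar>\<sigma>\<bar> = 1)"

lemma abs_weighted_le:
  fixes B c r v y :: real
  assumes "0 < r" "r \<le> v" "0 \<le> c" "\<bar>y\<bar> \<le> B"
  shows "\<bar>c / v * y\<bar> \<le> c / r * B"
proof -
  have "\<bar>c / v * y\<bar> = c / v * \<bar>y\<bar>"
    using assms by (simp add: abs_mult)
  also have "\<dots> \<le> c / r * B"
    using assms by (intro mult_mono frac_le) auto
  finally show ?thesis .
qed

lemma sum_inverse_sqrt_le: "(\<Sum>n = 1..N. 1 / sqrt (real n)) \<le> 2 * sqrt (real N)"
proof (induction N)
  case (Suc N)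
  define a b where "a = sqrt (real N)" and "b = sqrt (real (Suc N))"
  have ab: "0 \<le> a" "0 < b" "a \<le> b" "b ^ 2 = a ^ 2 + 1"
    by (simp_all add: a_def b_def)
  have "1 / b \<le> 2 * b - 2 * a"
  proof -
    have "0 \<le> (b - a) ^ 2"
      by simp
    then have "1 \<le> b * (2 * b - 2 * a)"
      using ab(4) by (simp add: power2_eq_square algebra_simps)
    then show ?thesis
      using ab(2) by (simp add: field_simps)
  qed
  then show ?case
    using Suc by (simp add: a_def b_def)
qed simp

text \<open>
  The partial sums grow at most like a power of the logarithm. A square root is a simpler bound
  that reproduces itself, since \<open>\<Sum>n\<le>N. 1 / sqrt n\<close> is at most \<open>2 sqrt N\<close>, and it still leaves room in
  the summability argument that follows.
\<close>

lemma T_partial_growth: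
  assumes "valid_seq s"
  shows "\<exists>C. \<forall>n. \<bar>T_partial s n\<bar> \<le> C * sqrt (real (n + 1)) \<and>
                 \<bar>T_partial s (n + 1) - T_partial s n\<bar> \<le> C / sqrt (real (n + 1))"
  using assms
proof (induction s rule: rev_induct)
  case Nil
  show ?case
    by (intro exI[of _ 1]) auto
next
  case (snoc x s)
  obtain k \<sigma> where x: "x = (k, \<sigma>)"
    by (cases x)
  have k: "1 \<le> k" "\<bar>\<sigma>\<bar> = 1" and "valid_seq s"
    using snoc.prems by (auto simp: valid_seq_def x)
  then obtain C where C: "\<And>n. \<bar>T_partial s n\<bar> \<le> C * sqrt (real (n + 1))"
    using snoc.IH by blast
  have "C \<ge> 0"
    using order.trans[OF abs_ge_zero C[of 0]] by simp
  define f where "f = (\<lambda>n. 2 * of_int \<sigma> ^ n / (2 * real n - real (length s + 1)) ^ k * T_partial s (n - 1))"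
  have P: "T_partial (s @ [x]) N = (\<Sum>n = 1..N. f n)" for N
    unfolding x T_partial_snoc f_def ..
  have f: "\<bar>f n\<bar> \<le> 2 * C / sqrt (real n)" if n: "n \<ge> 1" for n
  proof (cases "n - 1 < length s")
    case True
    then have "f n = 0"
      using T_partial_eq_0 by (simp add: f_def)
    then show ?thesis
      using \<open>C \<ge> 0\<close> by simp
  next
    case False
    define u where "u = 2 * real n - real (length s + 1)"
    have u: "real n \<le> u" "1 \<le> u"
      using False n by (auto simp: u_def)
    then have "u \<le> u ^ k"
      using k self_le_power[of u k] by simp
    then have uk: "real n \<le> u ^ k"
      using u by linarith
    have "\<bar>of_int \<sigma> :: real\<bar> = 1"
      using k(2) by linarith
    then have "\<bar>f n\<bar> = 2 / u ^ k * \<bar>T_partial s (n - 1)\<bar>"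
      using u unfolding f_def u_def[symmetric] by (simp add: abs_mult power_abs)
    also have "\<dots> \<le> 2 / real n * (C * sqrt (real n))"
      using C[of "n - 1"] n uk u by (intro mult_mono divide_left_mono) auto
    also have "\<dots> = 2 * C / sqrt (real n)"
      using n by (simp add: field_simps flip: power2_eq_square)
    finally show ?thesis .
  qed
  show ?case
  proof (intro exI[of _ "4 * C"] allI conjI)
    fix N
    have "\<bar>T_partial (s @ [x]) N\<bar> \<le> (\<Sum>n = 1..N. 2 * C * (1 / sqrt (real n)))"
      unfolding P by (rule order.trans[OF sum_abs], rule sum_mono) (use f in auto)
    also have "\<dots> \<le> 2 * C * (2 * sqrt (real N))"
      unfolding sum_distrib_left[symmetric] using \<open>C \<ge> 0\<close>
      by (intro mult_left_mono sum_inverse_sqrt_le) auto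
    also have "\<dots> \<le> 2 * C * (2 * sqrt (real (N + 1)))"
      using \<open>C \<ge> 0\<close> by (intro mult_left_mono) auto
    finally show "\<bar>T_partial (s @ [x]) N\<bar> \<le> 4 * C * sqrt (real (N + 1))"
      by simp
    have "\<bar>T_partial (s @ [x]) (N + 1) - T_partial (s @ [x]) N\<bar> = \<bar>f (N + 1)\<bar>"
      unfolding P by simp
    also have "\<dots> \<le> 2 * C / sqrt (real (N + 1))"
      by (rule f) simp
    also have "\<dots> \<le> 4 * C / sqrt (real (N + 1))"
      using \<open>C \<ge> 0\<close> by (intro divide_right_mono) auto
    finally show "\<bar>T_partial (s @ [x]) (N + 1) - T_partial (s @ [x]) N\<bar> \<le> 4 * C / sqrt (real (N + 1))" .
  qed
qed

text \<open>
  Twice the summand is the sum of a telescoping term and of \<open>\<plusminus>(f n - f (Suc n))\<close>, which is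
  absolutely summable.
\<close>

lemma summable_alternating_bounded_variation:
  fixes f :: "nat \<Rightarrow> real"
  assumes "f \<longlonglongrightarrow> 0" and "summable (\<lambda>n. \<bar>f (Suc n) - f n\<bar>)"
  shows "summable (\<lambda>n. (-1) ^ n * f n)"
proof -
  define g where "g = (\<lambda>n. (-1) ^ n * f n)"
  have "(\<lambda>n. \<bar>g n\<bar>) \<longlonglongrightarrow> 0"
    using tendsto_rabs_zero[OF assms(1)] by (simp add: g_def abs_mult power_abs)
  then have "summable (\<lambda>n. g n - g (Suc n))"
    by (rule telescope_summable'[OF tendsto_rabs_zero_cancel])
  moreover have "summable (\<lambda>n. (-1) ^ n * (f (Suc n) - f n))"
    by (rule summable_rabs_cancel) (use assms(2) in \<open>simp add: abs_mult power_abs\<close>)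
  ultimately have "summable (\<lambda>n. (g n - g (Suc n)) - (-1) ^ n * (f (Suc n) - f n))"
    by (rule summable_diff)
  also have "(\<lambda>n. (g n - g (Suc n)) - (-1) ^ n * (f (Suc n) - f n)) = (\<lambda>n. 2 * g n)"
    by (rule ext) (simp add: g_def right_diff_distrib)
  finally have "summable (\<lambda>n. (1/2) * (2 * g n))"
    by (rule summable_mult)
  then show ?thesis
    by (simp add: g_def)
qed

lemma summable_inverse_three_halves: "summable (\<lambda>n. 1 / (real (n + 1) * sqrt (real (n + 1))))"
proof -
  have "summable (\<lambda>n. real n powr (-3/2))"
    by (subst summable_real_powr_iff) simp
  then have "summable (\<lambda>n. real (n + 1) powr (-3/2))"
    by (rule summable_ignore_initial_segment)
  also have "(\<lambda>n. real (n + 1) powr (-3/2)) = (\<lambda>n. 1 / (real (n + 1) * sqrt (real (n + 1))))"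
  proof
    fix n
    define r where "r = real (n + 1)"
    have "r powr (-3/2) = 1 / r powr (1 + 1/2)"
      by (simp add: powr_minus_divide)
    also have "r powr (1 + 1/2) = r * sqrt r"
      by (subst powr_add) (simp add: powr_half_sqrt r_def)
    finally show "real (n + 1) powr (-3/2) = 1 / (real (n + 1) * sqrt (real (n + 1)))"
      by (simp add: r_def)
  qed
  finally show ?thesis .
qed

text \<open>
  For \<open>k = 1\<close> only the sign \<open>(-1)\<^sup>n\<close> gives convergence: the weighted inner partial sums tend to 0 and
  their increments are at most of order \<open>n\<close> to the power \<open>-3/2\<close>. For \<open>k \<ge> 2\<close> the series converges
  absolutely, with summands of at most that order.
\<close>

lemma summable_T_increments:
  assumes s: "valid_seq s" and k: "1 \<le> k"
  shows "summable (\<lambda>n. 2 * (-1) ^ n / (2 * real n - real (length s + 1)) ^ k * T_partial s (n - 1))"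
proof -
  obtain C where C: "\<And>n. \<bar>T_partial s n\<bar> \<le> C * sqrt (real (n + 1))"
      "\<And>n. \<bar>T_partial s (n + 1) - T_partial s n\<bar> \<le> C / sqrt (real (n + 1))"
    using T_partial_growth[OF s] by blast
  have "C \<ge> 0"
    using order.trans[OF abs_ge_zero C(1)[of 0]] by simp
  define u where "u = (\<lambda>n. 2 * real (n + 1) - real (length s + 1))"
  define f where "f = (\<lambda>n. 2 / u n ^ k * T_partial s n)"
  define h where "h = (\<lambda>n. 1 / (real (n + 1) * sqrt (real (n + 1))))"
  have h: "h n \<ge> 0" for n
    by (simp add: h_def)
  have u: "real (n + 1) \<le> u n" "1 \<le> u n" if "n \<ge> length s" for n
    using that by (auto simp: u_def)
  have "summable (\<lambda>n. (-1) ^ n * f n)"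
  proof (cases "k = 1")
    case True
    show ?thesis
    proof (rule summable_alternating_bounded_variation)
      have f_le: "\<bar>f n\<bar> \<le> 2 * C / sqrt (real (n + 1))" if "n \<ge> length s" for n
      proof -
        have "\<bar>f n\<bar> = 2 / u n * \<bar>T_partial s n\<bar>"
          using u[OF that] True by (simp add: f_def abs_mult)
        also have "\<dots> \<le> 2 / real (n + 1) * (C * sqrt (real (n + 1)))"
          using u[OF that] C(1)[of n] by (intro mult_mono divide_left_mono) auto
        also have "\<dots> = 2 * C / sqrt (real (n + 1))"
          by (simp add: field_simps flip: power2_eq_square)
        finally show ?thesis .
      qed
      show "f \<longlonglongrightarrow> 0"
      proof (rule Lim_null_comparison)
        show "\<forall>\<^sub>F n in sequentially. norm (f n) \<le> 2 * C / sqrt (real (n + 1))"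
          using f_le by (auto simp: eventually_at_top_linorder)
        have "filterlim (\<lambda>n. sqrt (real (n + 1))) at_top sequentially"
          using filterlim_compose[OF sqrt_at_top filterlim_compose[OF filterlim_real_sequentially filterlim_Suc]]
          by simp
        then show "(\<lambda>n. 2 * C / sqrt (real (n + 1))) \<longlonglongrightarrow> 0"
          by (intro tendsto_divide_0[OF tendsto_const] filterlim_at_top_imp_at_infinity)
      qed
      show "summable (\<lambda>n. \<bar>f (Suc n) - f n\<bar>)"
      proof (rule summable_comparison_test'[where g = "\<lambda>n. 6 * C * h n" and N = "length s"])
        show "summable (\<lambda>n. 6 * C * h n)"
          unfolding h_def by (intro summable_mult summable_inverse_three_halves)
        fix n assume n: "n \<ge> length s"
        have u2: "u (Suc n) = u n + 2"
          by (simp add: u_def)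
        note u = u[OF n]
        have "f (Suc n) - f n = 2 / u (Suc n) * (T_partial s (n + 1) - T_partial s n)
              - 4 / (u n * u (Suc n)) * T_partial s n"
        proof -
          have d: "2 / u n - 2 / u (Suc n) = 4 / (u n * u (Suc n))"
            using u by (simp add: u2 divide_simps)
          show ?thesis
            unfolding f_def True d[symmetric] by (simp add: algebra_simps)
        qed
        then have "\<bar>f (Suc n) - f n\<bar> \<le> \<bar>2 / u (Suc n) * (T_partial s (n + 1) - T_partial s n)\<bar>
            + \<bar>4 / (u n * u (Suc n)) * T_partial s n\<bar>"
          by linarith
        also have "\<bar>2 / u (Suc n) * (T_partial s (n + 1) - T_partial s n)\<bar>
            \<le> 2 / real (n + 1) * (C / sqrt (real (n + 1)))"
          by (rule abs_weighted_le[OF _ _ _ C(2)]) (use u u2 in auto)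
        also have "\<bar>4 / (u n * u (Suc n)) * T_partial s n\<bar>
            \<le> 4 / (real (n + 1) * real (n + 1)) * (C * sqrt (real (n + 1)))"
        proof (rule abs_weighted_le[OF _ _ _ C(1)])
          show "real (n + 1) * real (n + 1) \<le> u n * u (Suc n)"
            using u u2 by (intro mult_mono) auto
        qed auto
        also have "2 / real (n + 1) * (C / sqrt (real (n + 1)))
            + 4 / (real (n + 1) * real (n + 1)) * (C * sqrt (real (n + 1))) = 6 * C * h n"
        proof -
          define q where "q = sqrt (real (n + 1))"
          have q: "q > 0" "real (n + 1) = q * q"
            by (simp_all add: q_def)
          show ?thesis
            unfolding h_def q_def[symmetric] unfolding q(2) using q(1) by (simp add: field_simps)
        qed
        finally show "norm \<bar>f (Suc n) - f n\<bar> \<le> 6 * C * h n"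
          by simp
      qed
    qed
  next
    case False
    then have k2: "2 \<le> k"
      using k by simp
    show ?thesis
    proof (rule summable_comparison_test'[where g = "\<lambda>n. 2 * C * h n" and N = "length s"])
      show "summable (\<lambda>n. 2 * C * h n)"
        unfolding h_def by (intro summable_mult summable_inverse_three_halves)
      fix n assume n: "n \<ge> length s"
      note u = u[OF n]
      have "real (n + 1) ^ 2 \<le> u n ^ 2"
        using u by (intro power_mono) auto
      also have "\<dots> \<le> u n ^ k"
        using u k2 by (intro power_increasing) auto
      finally have "real (n + 1) * real (n + 1) \<le> u n ^ k"
        by (simp add: power2_eq_square)
      then have "\<bar>2 / u n ^ k * T_partial s n\<bar> \<le> 2 / (real (n + 1) * real (n + 1)) * (C * sqrt (real (n + 1)))"
        by (intro abs_weighted_le C) auto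
      also have "\<dots> = 2 * C * h n"
      proof -
        define q where "q = sqrt (real (n + 1))"
        have q: "q > 0" "real (n + 1) = q * q"
          by (simp_all add: q_def)
        show ?thesis
          unfolding h_def q_def[symmetric] unfolding q(2) using q(1) by (simp add: field_simps)
      qed
      finally show "norm ((-1) ^ n * f n) \<le> 2 * C * h n"
        by (simp add: f_def abs_mult power_abs)
    qed
  qed
  then have "summable (\<lambda>n. - ((-1) ^ n * f n))"
    by (rule summable_minus)
  then show ?thesis
    by (subst summable_Suc_iff[symmetric]) (simp add: f_def u_def mult_ac)
qed

lemma T_partial_sums_T:
  assumes s: "valid_seq s" and k: "1 \<le> k"
  shows "(\<lambda>n. 2 * (-1) ^ n / (2 * real n - real (length s + 1)) ^ k
              * (if n = 0 then 0 else T_partial s (n - 1))) sums T (s @ [bar k])"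
proof -
  define t where "t = (\<lambda>n. 2 * (-1) ^ n / (2 * real n - real (length s + 1)) ^ k
              * (if n = 0 then 0 else T_partial s (n - 1)))"
  define t' where "t' = (\<lambda>n. 2 * (-1) ^ n / (2 * real n - real (length s + 1)) ^ k * T_partial s (n - 1))"
  have "summable (\<lambda>n. t' (Suc n))"
    using summable_T_increments[OF assms] unfolding t'_def[symmetric] by (simp only: summable_Suc_iff)
  also have "(\<lambda>n. t' (Suc n)) = (\<lambda>n. t (Suc n))"
    by (simp add: t_def t'_def)
  finally have "summable t"
    by (simp only: summable_Suc_iff)
  then have "(\<lambda>N. \<Sum>n\<le>N. t n) \<longlonglongrightarrow> suminf t"
    using summable_LIMSEQ' by blast
  also have "(\<lambda>N. \<Sum>n\<le>N. t n) = T_partial (s @ [bar k])"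
  proof
    fix N
    have "(\<Sum>n\<le>N. t n) = (\<Sum>n=1..N. t n)"
      by (rule sum.mono_neutral_right) (auto simp: t_def)
    also have "\<dots> = T_partial (s @ [bar k]) N"
      unfolding bar_def T_partial_snoc by (intro sum.cong) (auto simp: t_def)
    finally show "(\<Sum>n\<le>N. t n) = T_partial (s @ [bar k]) N" .
  qed
  finally have "T (s @ [bar k]) = suminf t"
    unfolding T_def by (rule limI)
  moreover have "t sums suminf t"
    using \<open>summable t\<close> by (rule summable_sums)
  ultimately show ?thesis
    unfolding t_def by simp
qed

section \<open>T-values as limits of iterated integrals\<close>

text \<open>
  The part of the sum in which the largest index equals \<open>n\<close>.
\<close>

definition T_incr :: "signed_seq \<Rightarrow> nat \<Rightarrow> real" where
  "T_incr s n = T_partial s n - (if n = 0 then 0 else T_partial s (n - 1))"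

lemma sum_T_incr: "(\<Sum>n\<le>N. T_incr s n) = T_partial s N"
  by (induction N) (auto simp: T_incr_def)

lemma T_incr_eq_0: "n < length s \<Longrightarrow> T_incr s n = 0"
  by (auto simp: T_incr_def T_partial_eq_0)

lemma T_incr_snoc:
  "T_incr (s @ [(k, \<sigma>)]) n =
     2 * of_int \<sigma> ^ n / (2 * real n - real (length s + 1)) ^ k * (if n = 0 then 0 else T_partial s (n - 1))"
proof (cases n)
  case (Suc m)
  have "{1..n} = insert n {1..m}"
    using Suc by auto
  then show ?thesis
    using Suc by (simp add: T_incr_def T_partial_snoc)
qed (simp add: T_incr_def T_partial_eq_0)

definition pole_form :: "int \<Rightarrow> form" where
  "pole_form \<tau> = (if \<tau> = 1 then Artanh else Arctan)"

text \<open>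
  The word of a signed sequence that is given in reverse order, so that the outermost form is
  produced first. The parameter \<open>\<epsilon>\<close> is the product of the signs of the entries further out; the
  sign that selects a form is the product of its own sign with all of these.
\<close>

fun outer_word :: "int \<Rightarrow> signed_seq \<Rightarrow> form list" where
  "outer_word \<epsilon> [] = []"
| "outer_word \<epsilon> ((k, \<sigma>) # s) = replicate (k - 1) Log @ pole_form (\<epsilon> * \<sigma>) # outer_word (\<epsilon> * \<sigma>) s"

definition word_sign :: "form list \<Rightarrow> real" where
  "word_sign w = prod_list (map sgn_form w)"

lemma word_sign_simps [simp]:
  "word_sign [] = 1" "word_sign (a # w) = sgn_form a * word_sign w"
  "word_sign (v @ w) = word_sign v * word_sign w"
  "word_sign (replicate n a) = sgn_form a ^ n"
  by (simp_all add: word_sign_def prod_list_replicate)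

lemma word_sign_rev [simp]: "word_sign (rev w) = word_sign w"
  by (induction w) simp_all

lemma coeff_replicate_Log: "coeff (replicate j Log @ w) n = coeff w n / real n ^ j"
  by (induction j) auto

text \<open>
  Writing \<open>q j = 2 * n j - j\<close> for the exponents that successive Cauchy products run through, the gaps
  \<open>q (j + 1) - q j\<close> are odd because the densities are even. Hence only exponents of the parity of the
  length occur, and they correspond to the indices \<open>n j\<close> of the sum. The sign \<open>\<tau> j\<close> of form \<open>j\<close> enters
  to the power \<open>n j - n (j - 1) - 1\<close>; as \<open>\<tau> j * \<tau> (j + 1)\<close> is the sign of entry \<open>j\<close>, this leaves the signs
  of the sequence to the powers \<open>n j\<close>, \<open>\<epsilon>\<close> to the power of the largest index, and the constant \<open>word_sign\<close>. The statement about vanishing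
  coefficients is part of the induction because the convolution runs over all exponents.
\<close>

lemma coeff_outer_word:
  assumes "valid_seq s" and "\<bar>\<epsilon>\<bar> = 1"
  shows "(N < length s \<or> odd (N - length s) \<longrightarrow> coeff (outer_word \<epsilon> (rev s)) N = 0) \<and>
         coeff (outer_word \<epsilon> (rev s)) (length s + 2 * i) =
           word_sign (outer_word \<epsilon> (rev s)) * of_int \<epsilon> ^ (length s + i) * T_incr s (length s + i)"
  using assms
proof (induction s arbitrary: \<epsilon> N i rule: rev_induct)
  case Nil
  show ?case
    by (auto simp: T_incr_def)
next
  case (snoc x s)
  obtain k \<sigma> where x: "x = (k, \<sigma>)"
    by (cases x)
  have k: "1 \<le> k" "\<bar>\<sigma>\<bar> = 1" and s: "valid_seq s"
    using snoc.prems by (auto simp: valid_seq_def x)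
  define \<delta> where "\<delta> = \<epsilon> * \<sigma>"
  have \<delta>: "\<bar>\<delta>\<bar> = 1"
    using k snoc.prems by (simp add: \<delta>_def abs_mult)
  define L where "L = length s"
  define w where "w = outer_word \<delta> (rev s)"
  define a where "a = pole_form \<delta>"
  have a: "a \<noteq> Log" "sgn_form a = of_int \<delta>"
    using \<delta> by (auto simp: a_def pole_form_def)
  have \<delta>2: "of_int \<delta> * of_int \<delta> = (1 :: real)"
    using \<delta> by (auto simp: abs_if split: if_splits)
  have word: "outer_word \<epsilon> (rev (s @ [x])) = replicate (k - 1) Log @ a # w"
    by (simp add: x w_def a_def \<delta>_def)
  have IH: "coeff w q = 0" if "q < L \<or> odd (q - L)" for q
    using snoc.IH[OF s \<delta>] that unfolding w_def L_def by blast
  have IH': "coeff w (L + 2 * j) = word_sign w * of_int \<delta> ^ (L + j) * T_incr s (L + j)" for j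
    using snoc.IH[OF s \<delta>] by (simp add: w_def L_def)
  have vanish: "coeff w q * density_coeff a (N - 1 - q) = 0"
    if "N < L + 1 \<or> odd (N - (L + 1))" "q < N" for q N
  proof (cases "q < L \<or> odd (q - L)")
    case False
    then have "odd (N - 1 - q)"
      using that by presburger
    then show ?thesis
      by (simp add: density_coeff_def)
  qed (use IH in simp)
  have zero: "coeff (replicate (k - 1) Log @ a # w) N = 0" if "N < L + 1 \<or> odd (N - (L + 1))" for N
  proof -
    have "(\<Sum>q<N. coeff w q * density_coeff a (N - 1 - q)) = 0"
      using vanish[OF that] by (intro sum.neutral) auto
    then show ?thesis
      using a by (simp add: coeff_replicate_Log)
  qed
  have "(\<Sum>q<L + 1 + 2 * i. coeff w q * density_coeff a (L + 1 + 2 * i - 1 - q))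
      = (\<Sum>q\<in>(\<lambda>j. L + 2 * j) ` {..i}. coeff w q * density_coeff a (L + 1 + 2 * i - 1 - q))"
  proof (rule sum.mono_neutral_right)
    show "\<forall>q\<in>{..<L + 1 + 2 * i} - (\<lambda>j. L + 2 * j) ` {..i}. coeff w q * density_coeff a (L + 1 + 2 * i - 1 - q) = 0"
    proof
      fix q assume q: "q \<in> {..<L + 1 + 2 * i} - (\<lambda>j. L + 2 * j) ` {..i}"
      have "q < L \<or> odd (q - L)"
      proof (rule ccontr)
        assume "\<not> (q < L \<or> odd (q - L))"
        then obtain j where "q = L + 2 * j"
          by (metis evenE le_add_diff_inverse not_less)
        then show False
          using q by auto
      qed
      then show "coeff w q * density_coeff a (L + 1 + 2 * i - 1 - q) = 0"
        using IH by simp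
    qed
  qed auto
  also have "\<dots> = (\<Sum>j\<le>i. coeff w (L + 2 * j) * density_coeff a (2 * i - 2 * j))"
    by (subst sum.reindex) (auto simp: inj_on_def)
  also have "\<dots> = (\<Sum>j\<le>i. 2 * word_sign w * of_int \<delta> ^ (L + i) * T_incr s (L + j))"
  proof (intro sum.cong refl)
    fix j assume j: "j \<in> {..i}"
    have "2 * i - 2 * j = 2 * (i - j)"
      by simp
    then have "density_coeff a (2 * i - 2 * j) = 2 * of_int \<delta> ^ (i - j)"
      using a by (simp add: density_coeff_def)
    moreover have "L + i = (L + j) + (i - j)"
      using j by simp
    ultimately show "coeff w (L + 2 * j) * density_coeff a (2 * i - 2 * j)
        = 2 * word_sign w * of_int \<delta> ^ (L + i) * T_incr s (L + j)"
      unfolding IH' by (simp only: power_add) simp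
  qed
  also have "\<dots> = 2 * word_sign w * of_int \<delta> ^ (L + i) * (\<Sum>j\<le>i. T_incr s (L + j))"
    by (simp add: sum_distrib_left)
  also have "(\<Sum>j\<le>i. T_incr s (L + j)) = (\<Sum>n\<in>(\<lambda>j. L + j) ` {..i}. T_incr s n)"
    by (subst sum.reindex) (auto simp: inj_on_def)
  also have "\<dots> = (\<Sum>n\<le>L + i. T_incr s n)"
  proof (rule sum.mono_neutral_left)
    show "\<forall>n\<in>{..L + i} - (\<lambda>j. L + j) ` {..i}. T_incr s n = 0"
    proof
      fix n assume n: "n \<in> {..L + i} - (\<lambda>j. L + j) ` {..i}"
      have "n < L"
      proof (rule ccontr)
        assume "\<not> n < L"
        then have "n = L + (n - L)" "n - L \<le> i"
          using n by auto
        then show False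
          using n by blast
      qed
      then show "T_incr s n = 0"
        by (simp add: T_incr_eq_0 L_def)
    qed
  qed auto
  also have "\<dots> = T_partial s (L + i)"
    by (rule sum_T_incr)
  finally have conv: "(\<Sum>q<L + 1 + 2 * i. coeff w q * density_coeff a (L + 1 + 2 * i - 1 - q))
      = 2 * word_sign w * of_int \<delta> ^ (L + i) * T_partial s (L + i)" .
  have "coeff (replicate (k - 1) Log @ a # w) (L + 1 + 2 * i)
      = (\<Sum>q<L + 1 + 2 * i. coeff w q * density_coeff a (L + 1 + 2 * i - 1 - q))
          / real (L + 1 + 2 * i) / real (L + 1 + 2 * i) ^ (k - 1)"
    unfolding coeff_replicate_Log using a(1) by simp
  also have "\<dots> = 2 * word_sign w * of_int \<delta> ^ (L + i) * T_partial s (L + i) / real (L + 1 + 2 * i) ^ k"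
    unfolding conv using k(1) by (cases k) (auto simp: divide_divide_eq_left)
  also have "\<dots> = word_sign (replicate (k - 1) Log @ a # w) * of_int \<epsilon> ^ (L + 1 + i) * T_incr (s @ [x]) (L + 1 + i)"
  proof -
    have d: "of_int \<delta> * (of_int \<epsilon> ^ (L + 1 + i) * of_int \<sigma> ^ (L + 1 + i)) = (of_int \<delta> ^ (L + i) :: real)"
    proof -
      have "of_int \<epsilon> ^ (L + 1 + i) * of_int \<sigma> ^ (L + 1 + i) = (of_int \<delta> ^ (L + 1 + i) :: real)"
        by (simp add: \<delta>_def power_mult_distrib)
      also have "of_int \<delta> * \<dots> = (of_int \<delta> * of_int \<delta>) * (of_int \<delta> ^ (L + i) :: real)"
        by simp
      finally show ?thesis
        unfolding \<delta>2 by simp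
    qed
    have "T_incr (s @ [x]) (L + 1 + i) = 2 * of_int \<sigma> ^ (L + 1 + i) / real (L + 1 + 2 * i) ^ k * T_partial s (L + i)"
      unfolding x T_incr_snoc by (simp add: L_def)
    moreover have "word_sign (replicate (k - 1) Log @ a # w) = of_int \<delta> * word_sign w"
      using a by simp
    moreover have "2 * word_sign w * of_int \<delta> ^ (L + i) * T_partial s (L + i) / real (L + 1 + 2 * i) ^ k
      = (of_int \<delta> * word_sign w) * of_int \<epsilon> ^ (L + 1 + i)
          * (2 * of_int \<sigma> ^ (L + 1 + i) / real (L + 1 + 2 * i) ^ k * T_partial s (L + i))"
      unfolding d[symmetric] by (simp only: mult_ac times_divide_eq_left times_divide_eq_right)
    ultimately show ?thesis
      by (simp only:)
  qed
  finally show ?case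
    unfolding word using zero by (simp add: L_def)
qed

definition endvalue :: "form list \<Rightarrow> real \<Rightarrow> bool" where
  "endvalue w v \<longleftrightarrow> ((hyperlog w) \<longlongrightarrow> v) (at_left 1)"

text \<open>
  The power series at 1 is the series of the increments of \<open>T\<close>, spread out over every second
  exponent, so Abel's theorem applies.
\<close>

lemma endvalue_T:
  assumes s: "valid_seq s" and k: "1 \<le> k"
  defines "w \<equiv> outer_word 1 (bar k # rev s)"
  shows "endvalue w (word_sign w * T (s @ [bar k]))"
proof -
  define s' where "s' = s @ [bar k]"
  define L where "L = length s'"
  have w: "w = outer_word 1 (rev s')"
    by (simp add: w_def s'_def)
  have s': "valid_seq s'"
    using s k by (auto simp: valid_seq_def s'_def bar_def)
  have coeff_0: "coeff w N = 0" if "N < L \<or> odd (N - L)" for N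
    using coeff_outer_word[OF s' abs_one, of N] that unfolding w L_def by blast
  have coeff: "coeff w (L + 2 * i) = word_sign w * T_incr s' (L + i)" for i
    using coeff_outer_word[OF s', of 1 0 i] unfolding w L_def by simp
  have "T_incr s' sums T s'"
    using T_partial_sums_T[OF s k] unfolding s'_def bar_def T_incr_snoc by simp
  then have "(\<lambda>i. T_incr s' (L + i)) sums T s'"
  proof (subst sums_mono_reindex)
    show "T_incr s' n = 0" if "n \<notin> range ((+) L)" for n
    proof (rule T_incr_eq_0, rule ccontr)
      assume "\<not> n < length s'"
      then have "n = L + (n - L)"
        by (simp add: L_def)
      then show False
        using that by blast
    qed
  qed (auto simp: strict_mono_def)
  then have "(\<lambda>i. word_sign w * T_incr s' (L + i)) sums (word_sign w * T s')"
    by (rule sums_mult)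
  also have "(\<lambda>i. word_sign w * T_incr s' (L + i)) = (\<lambda>i. coeff w (L + 2 * i))"
    by (simp only: coeff)
  also have "\<dots> sums (word_sign w * T s') \<longleftrightarrow> coeff w sums (word_sign w * T s')"
  proof (rule sums_mono_reindex)
    show "coeff w n = 0" if "n \<notin> range (\<lambda>i. L + 2 * i)" for n
    proof -
      have "n < L \<or> odd (n - L)"
      proof (rule ccontr)
        assume "\<not> (n < L \<or> odd (n - L))"
        then obtain j where "n = L + 2 * j"
          by (metis evenE le_add_diff_inverse not_less)
        then show False
          using that by auto
      qed
      then show ?thesis
        by (rule coeff_0)
    qed
  qed (auto simp: strict_mono_def)
  finally show ?thesis
    unfolding endvalue_def hyperlog_def s'_def by (rule abel_limit)
qed

section \<open>Duality\<close>

fun dual :: "form \<Rightarrow> form" where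
  "dual Log = Artanh" | "dual Artanh = Log" | "dual Arctan = Arctan"

text \<open>
  This involution of \<open>(0, 1)\<close> pulls \<open>dt/t\<close> back to \<open>- 2 dt/(1 - t\<^sup>2)\<close> and vice versa, and
  \<open>2 dt/(1 + t\<^sup>2)\<close> to its negative.
\<close>

definition mobius :: "real \<Rightarrow> real" where
  "mobius t = (1 - t) / (1 + t)"

lemma mobius_props:
  assumes "0 < t" "t < 1"
  shows "0 < mobius t" "mobius t < 1" "mobius (mobius t) = t"
  using assms by (auto simp: mobius_def divide_simps)

text \<open>
  The function of \<open>t\<close> is the iterated integral over the simplex between \<open>t\<close> and 1, with the head of
  \<open>a # w\<close> as the form nearest to \<open>t\<close>. Differentiation with respect to the lower limit gives the
  minus sign.
\<close>

lemma DERIV_hyperlog_mobius: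
  assumes t: "0 < t" "t < 1" and w: "last (dual a # map dual w) \<noteq> Log"
  shows "((\<lambda>t. hyperlog (map dual (a # w)) (mobius t)) has_real_derivative
           - density a t * hyperlog (map dual w) (mobius t)) (at t)"
proof -
  have m: "(mobius has_real_derivative (- 2 / (1 + t) ^ 2)) (at t)"
    unfolding mobius_def using t
    by (auto intro!: derivative_eq_intros simp: power2_eq_square field_simps)
  have "((\<lambda>t. hyperlog (dual a # map dual w) (mobius t)) has_real_derivative
      density (dual a) (mobius t) * hyperlog (map dual w) (mobius t) * (- 2 / (1 + t) ^ 2)) (at t)"
    using DERIV_chain2[OF DERIV_hyperlog[OF mobius_props(1,2)[OF t] w] m] .
  moreover have "density (dual a) (mobius t) * (- 2 / (1 + t) ^ 2) = - density a t"
  proof (cases a)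
    case Log
    have "1 - mobius t ^ 2 = 4 * t / (1 + t) ^ 2"
      using t by (simp add: mobius_def power_divide divide_simps) (simp add: power2_eq_square algebra_simps)
    then show ?thesis
      using t by (simp add: Log divide_simps)
  next
    case Artanh
    have "1 - t ^ 2 = (1 - t) * (1 + t)"
      by (simp add: power2_eq_square algebra_simps)
    then have "density a t = 2 / ((1 - t) * (1 + t))"
      by (simp add: Artanh)
    moreover have "density (dual a) (mobius t) = (1 + t) / (1 - t)"
      by (simp add: Artanh mobius_def)
    moreover have "(1 + t) / (1 - t) * (- 2 / (1 + t) ^ 2) = - (2 / ((1 - t) * (1 + t)))"
      using t by (simp add: divide_simps) (simp add: power2_eq_square algebra_simps)
    ultimately show ?thesis
      by simp
  next
    case Arctan
    have "1 + mobius t ^ 2 = 2 * (1 + t ^ 2) / (1 + t) ^ 2"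
      using t by (simp add: mobius_def power_divide divide_simps) (simp add: power2_eq_square algebra_simps)
    moreover have "1 + t ^ 2 > 0"
      by (simp add: add_pos_nonneg)
    ultimately show ?thesis
      using t by (simp add: Arctan divide_simps)
  qed
  moreover have "density (dual a) (mobius t) * hyperlog (map dual w) (mobius t) * (- 2 / (1 + t) ^ 2)
      = density (dual a) (mobius t) * (- 2 / (1 + t) ^ 2) * hyperlog (map dual w) (mobius t)"
    by (simp only: mult_ac)
  ultimately show ?thesis
    by (simp only: list.map)
qed

lemma tendsto_0_if_sqrt_bound:
  fixes f :: "real \<Rightarrow> real"
  assumes "\<And>t. 0 < t \<Longrightarrow> t < 1 \<Longrightarrow> \<bar>f t\<bar> \<le> C * (sqrt t * sqrt (1 - t))"
  shows "(f \<longlongrightarrow> 0) (at_left 1)" "(f \<longlongrightarrow> 0) (at_right 0)"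
proof -
  have lim: "((\<lambda>t. C * (sqrt t * sqrt (1 - t))) \<longlongrightarrow> 0) (at a within S)" if "a = 0 \<or> a = 1" for a S
  proof -
    have "((\<lambda>t. C * (sqrt t * sqrt (1 - t))) \<longlongrightarrow> C * (sqrt a * sqrt (1 - a))) (at a within S)"
      by (intro tendsto_intros)
    then show ?thesis
      using that by auto
  qed
  show "(f \<longlongrightarrow> 0) (at_left 1)"
  proof (rule Lim_null_comparison[OF _ lim])
    show "\<forall>\<^sub>F t in at_left 1. norm (f t) \<le> C * (sqrt t * sqrt (1 - t))"
      using eventually_at_left_real[of 0 "1::real"] by (auto elim!: eventually_mono intro!: assms)
  qed simp
  show "(f \<longlongrightarrow> 0) (at_right 0)"
  proof (rule Lim_null_comparison[OF _ lim])
    show "\<forall>\<^sub>F t in at_right 0. norm (f t) \<le> C * (sqrt t * sqrt (1 - t))"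
      using eventually_at_right_real[of 0 "1::real"] by (auto elim!: eventually_mono intro!: assms)
  qed simp
qed

text \<open>
  At each end of the interval the zero of one factor beats the growth of the other, by half an
  order.
\<close>

lemma abs_hyperlog_mobius_product_le:
  assumes t: "0 < t" "t < 1" and u: "u \<noteq> []" "last u \<noteq> Log" and v: "v \<noteq> []" "last v \<noteq> Log"
  shows "\<bar>hyperlog u t * hyperlog v (mobius t)\<bar> \<le> 4 ^ (length u + length v) * (sqrt t * sqrt (1 - t))"
proof -
  define m where "m = mobius t"
  have m: "0 < m" "m < 1"
    using mobius_props[OF t] by (auto simp: m_def)
  have m_le: "m / sqrt (1 - m) \<le> (1 - t) / sqrt t"
  proof (rule frac_le)
    show "m \<le> 1 - t"
      using t by (simp add: m_def mobius_def divide_simps mult_left_le)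
    have "1 - m = 2 * t / (1 + t)"
      using t by (simp add: m_def mobius_def field_simps)
    also have "\<dots> \<ge> t"
      using t mult_left_le[of t t] by (simp add: field_simps)
    finally show "sqrt t \<le> sqrt (1 - m)"
      by simp
  qed (use t in auto)
  have "\<bar>hyperlog u t * hyperlog v m\<bar> \<le>
      4 ^ length u * (t / sqrt (1 - t)) * (4 ^ length v * (m / sqrt (1 - m)))"
    unfolding abs_mult using abs_hyperlog_le[OF u, of t] abs_hyperlog_le[OF v, of m] t m
    by (intro mult_mono) auto
  also have "\<dots> \<le> 4 ^ length u * (t / sqrt (1 - t)) * (4 ^ length v * ((1 - t) / sqrt t))"
    using m_le t by (intro mult_left_mono) auto
  also have "\<dots> = 4 ^ (length u + length v) * ((t / sqrt t) * ((1 - t) / sqrt (1 - t)))"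
    by (simp add: power_add mult_ac)
  also have "\<dots> = 4 ^ (length u + length v) * (sqrt t * sqrt (1 - t))"
    using t by (simp add: real_div_sqrt)
  finally show ?thesis
    by (simp add: m_def)
qed

text \<open>
  Cut \<open>U\<close> at each of its \<open>n + 1\<close> positions and multiply the integral of the first part from 0 to \<open>t\<close>
  by the integral of the second part from \<open>t\<close> to 1. The derivatives of these products telescope to
  0, so their sum \<open>Q\<close> is constant. As \<open>t\<close> tends to 1 only the cut after the last letter survives,
  and as \<open>t\<close> tends to 0 only the cut before the first one; these are the two values to be compared.
  The two conditions on the ends of \<open>U\<close> make both integrals converge at their starting points.
\<close>

theorem endvalue_dual:
  assumes U: "U \<noteq> []" "hd U \<noteq> Log" "last U \<noteq> Artanh"
    and C: "endvalue (rev U) C"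
  shows "endvalue (map dual U) C"
proof -
  define n where "n = length U"
  define F where "F = (\<lambda>a. hyperlog (rev (take a U)))"
  define D where "D = (\<lambda>a t. hyperlog (map dual (drop a U)) (mobius t))"
  define p where "p = (\<lambda>a t. density (U ! a) t * F a t * D (Suc a) t)"
  have n: "n > 0"
    using U by (simp add: n_def)
  have last_F: "last (rev (take a U)) \<noteq> Log" if "0 < a" for a
    using U that by (cases U; cases a) auto
  have last_D: "last (map dual (drop a U)) \<noteq> Log" if "a < n" for a
    using U that by (cases "last U") (auto simp: last_map n_def last_drop)
  have take_Suc: "rev (take (Suc a) U) = U ! a # rev (take a U)" if "a < n" for a
    using that by (simp add: n_def take_Suc_conv_app_nth)
  have drop_Suc: "drop a U = U ! a # drop (Suc a) U" if "a < n" for a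
    using that by (simp add: n_def Cons_nth_drop_Suc)
  have DF: "(F (Suc a) has_real_derivative density (U ! a) t * F a t) (at t)"
    if "a < n" "0 < t" "t < 1" for a t
    using DERIV_hyperlog[of t "U ! a" "rev (take a U)"] last_F[of "Suc a"] that
    by (simp add: F_def take_Suc)
  have DD: "(D a has_real_derivative - density (U ! a) t * D (Suc a) t) (at t)"
    if "a < n" "0 < t" "t < 1" for a t
    using DERIV_hyperlog_mobius[of t "U ! a" "drop (Suc a) U"] last_D[of a] that
    unfolding D_def drop_Suc[OF that(1)] by simp
  have F0: "F 0 = (\<lambda>_. 1)" and Dn: "D n = (\<lambda>_. 1)"
    by (auto simp: F_def D_def n_def)
  \<comment> \<open>The cuts at the two ends are kept apart because only they have nonzero limits.\<close>
  define Q where "Q = (\<lambda>t. D 0 t + (\<Sum>a\<in>{0<..<n}. F a t * D a t) + F n t)"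
  have Q': "(Q has_real_derivative 0) (at t)" if t: "0 < t" "t < 1" for t
  proof -
    have mid: "((\<lambda>t. F a t * D a t) has_real_derivative (p (a - 1) t - p a t)) (at t)"
      if "a \<in> {0<..<n}" for a
    proof -
      obtain b where a: "a = Suc b" "b < n"
        using \<open>a \<in> {0<..<n}\<close> by (cases a) auto
      have "((\<lambda>t. F a t * D a t) has_real_derivative
          density (U ! b) t * F b t * D a t + - density (U ! a) t * D (Suc a) t * F a t) (at t)"
        using DERIV_mult[OF DF[OF a(2) t] DD[of a t]] that t unfolding a(1) by simp
      then show ?thesis
        by (simp add: p_def a(1) mult_ac)
    qed
    have first: "(D 0 has_real_derivative - p 0 t) (at t)"
      using DD[of 0 t] n t by (simp add: p_def F0)
    have last: "(F n has_real_derivative p (n - 1) t) (at t)"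
      using DF[of "n - 1" t] n t by (simp add: p_def Dn)
    have "(Q has_real_derivative (- p 0 t + (\<Sum>a\<in>{0<..<n}. p (a - 1) t - p a t) + p (n - 1) t)) (at t)"
      unfolding Q_def by (intro DERIV_add DERIV_sum first mid last)
    moreover have "(\<Sum>a\<in>{0<..<Suc k}. p (a - 1) t - p a t) = p 0 t - p k t" for k
    proof (induction k)
      case (Suc k)
      have "{0<..<Suc (Suc k)} = insert (Suc k) {0<..<Suc k}"
        by auto
      then show ?case
        using Suc by simp
    qed auto
    from this[of "n - 1"] have "(\<Sum>a\<in>{0<..<n}. p (a - 1) t - p a t) = p 0 t - p (n - 1) t"
      using n by simp
    ultimately show ?thesis
      by simp
  qed
  have Q_const: "Q t = Q (1/2)" if "0 < t" "t < 1" for t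
    by (rule DERIV_isconst3[of 0 1]) (use Q' that in auto)
  have mid_bound: "\<bar>F a t * D a t\<bar> \<le> 4 ^ (length (rev (take a U)) + length (map dual (drop a U))) * (sqrt t * sqrt (1 - t))"
    if "a \<in> {0<..<n}" "0 < t" "t < 1" for a t
    unfolding F_def D_def using that last_F[of a] last_D[of a]
    by (intro abs_hyperlog_mobius_product_le) (auto simp: n_def)
  have mid_lims: "((\<lambda>t. \<Sum>a\<in>{0<..<n}. F a t * D a t) \<longlongrightarrow> 0) (at_left 1)"
    "((\<lambda>t. \<Sum>a\<in>{0<..<n}. F a t * D a t) \<longlongrightarrow> 0) (at_right 0)"
    by (intro tendsto_null_sum tendsto_0_if_sqrt_bound[OF mid_bound], assumption+)+
  have cont0: "(hyperlog (a # w) \<longlongrightarrow> 0) (at_right 0)" for a w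
    using isCont_hyperlog[of 0 "a # w"] unfolding isCont_def
    by (auto intro: tendsto_mono[OF at_le])
  have mobius_to_0: "filterlim mobius (at_right 0) (at_left 1)"
  proof -
    have "(mobius \<longlongrightarrow> (1 - 1) / (1 + 1)) (at_left 1)"
      unfolding mobius_def by (intro tendsto_intros) auto
    moreover have "\<forall>\<^sub>F t in at_left 1. mobius t \<in> {0<..} \<and> mobius t \<noteq> 0"
      using eventually_at_left_real[of 0 "1::real"]
      by (auto elim!: eventually_mono dest: mobius_props)
    ultimately show ?thesis
      unfolding filterlim_at by simp
  qed
  obtain a w where Ua: "U = a # w"
    using U by (cases U) auto
  have D0: "(D 0 \<longlongrightarrow> 0) (at_left 1)"
    using filterlim_compose[OF cont0 mobius_to_0] by (simp add: D_def Ua)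
  have Fn: "F n = hyperlog (rev U)"
    by (simp add: F_def n_def)
  have "(Q \<longlongrightarrow> 0 + 0 + C) (at_left 1)"
    unfolding Q_def using C unfolding Fn endvalue_def by (intro tendsto_add D0 mid_lims)
  moreover have "(Q \<longlongrightarrow> Q (1/2)) (at_left 1)"
    using eventually_at_left_real[of 0 "1::real"]
    by (intro tendsto_eventually) (auto elim!: eventually_mono intro: Q_const)
  ultimately have C_eq: "Q (1/2) = C"
    using tendsto_unique[of "at_left (1::real)"] by fastforce
  obtain b v where Ub: "rev U = b # v"
    using U by (cases "rev U") auto
  have "(F n \<longlongrightarrow> 0) (at_right 0)"
    unfolding Fn Ub by (rule cont0)
  then have "((\<lambda>t. Q (1/2) - (\<Sum>a\<in>{0<..<n}. F a t * D a t) - F n t) \<longlongrightarrow> C - 0 - 0) (at_right 0)"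
    unfolding C_eq by (intro tendsto_diff tendsto_const mid_lims)
  then have "((\<lambda>t. Q (1/2) - (\<Sum>a\<in>{0<..<n}. F a (mobius t) * D a (mobius t)) - F n (mobius t)) \<longlongrightarrow> C) (at_left 1)"
    using filterlim_compose[OF _ mobius_to_0] by fastforce
  moreover have "\<forall>\<^sub>F t in at_left 1. Q (1/2) - (\<Sum>a\<in>{0<..<n}. F a (mobius t) * D a (mobius t)) - F n (mobius t)
      = hyperlog (map dual U) t"
    using eventually_at_left_real[of 0 "1::real", simplified]
  proof eventually_elim
    case (elim t)
    have "Q (1/2) = Q (mobius t)"
      using Q_const[of "mobius t"] mobius_props[of t] elim by simp
    then show ?case
      using mobius_props[of t] elim by (simp add: Q_def D_def)
  qed
  ultimately show ?thesis
    unfolding endvalue_def by (rule Lim_transform_eventually)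
qed

section \<open>Shuffling with powers of the logarithm\<close>

lemma finite_compositions: "finite (compositions w d)"
proof (rule finite_subset)
  show "compositions w d \<subseteq> {js. set js \<subseteq> {..w} \<and> length js = d}"
    using member_le_sum_list by (fastforce simp: compositions_def)
  show "finite {js. set js \<subseteq> {..w} \<and> length js = d}"
    by (rule finite_lists_length_eq) simp
qed

text \<open>
  The first part is either 1 and is dropped, or it is larger and is decreased. On words this
  distinguishes whether the outermost form is a letter of \<open>vs\<close> or one of the \<open>Artanh\<close> forms shuffled in.
\<close>

lemma sum_compositions_Suc:
  fixes f :: "nat list \<Rightarrow> real"
  shows "(\<Sum>js\<in>compositions (Suc w) (Suc d). f js)
    = (\<Sum>js\<in>compositions w d. f (1 # js)) + (\<Sum>js\<in>compositions w (Suc d). f (Suc (hd js) # tl js))"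
proof -
  let ?A = "(#) 1 ` compositions w d" and ?B = "(\<lambda>js. Suc (hd js) # tl js) ` compositions w (Suc d)"
  have "compositions (Suc w) (Suc d) = ?A \<union> ?B"
  proof (intro equalityI subsetI)
    fix js assume js: "js \<in> compositions (Suc w) (Suc d)"
    then obtain j js' where eq: "js = j # js'"
      by (cases js) (auto simp: compositions_def)
    show "js \<in> ?A \<union> ?B"
    proof (cases "j = 1")
      case True
      then show ?thesis
        using js by (auto simp: eq compositions_def)
    next
      case False
      then have "js = Suc (hd ((j - 1) # js')) # tl ((j - 1) # js')" "(j - 1) # js' \<in> compositions w (Suc d)"
        using js by (auto simp: eq compositions_def)
      then show ?thesis
        by blast
    qed
  next
    fix js assume "js \<in> ?A \<union> ?B"
    then show "js \<in> compositions (Suc w) (Suc d)"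
      by (auto simp: compositions_def length_Suc_conv)
  qed
  moreover have "?A \<inter> ?B = {}"
  proof -
    have "hd js \<noteq> 0" if "js \<in> compositions w (Suc d)" for js
      using that by (cases js) (auto simp: compositions_def)
    then show ?thesis
      by fastforce
  qed
  moreover have "(\<Sum>js\<in>?A. f js) = (\<Sum>js\<in>compositions w d. f (1 # js))"
    by (subst sum.reindex) auto
  moreover have "(\<Sum>js\<in>?B. f js) = (\<Sum>js\<in>compositions w (Suc d). f (Suc (hd js) # tl js))"
  proof (subst sum.reindex)
    show "inj_on (\<lambda>js. Suc (hd js) # tl js) (compositions w (Suc d))"
    proof (rule inj_onI)
      fix js js' assume "js \<in> compositions w (Suc d)" "js' \<in> compositions w (Suc d)"
        and "Suc (hd js) # tl js = Suc (hd js') # tl js'"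
      then show "js = js'"
        by (cases js; cases js') (auto simp: compositions_def)
    qed
  qed simp
  ultimately show ?thesis
    using sum.union_disjoint[of ?A ?B f] by (simp add: finite_compositions)
qed

text \<open>
  The part \<open>j\<close> of the composition stands for a letter followed by \<open>j - 1\<close> copies of the filler. The
  filler is \<open>Log\<close> for the words of \<open>T\<close>-values and \<open>Artanh\<close> for their duals.
\<close>

definition weave :: "form \<Rightarrow> form list \<Rightarrow> nat list \<Rightarrow> form list" where
  "weave a vs js = concat (map2 (\<lambda>v j. v # replicate (j - 1) a) vs js)"

lemma weave_Cons [simp]: "weave a (v # vs) (j # js) = v # replicate (j - 1) a @ weave a vs js"
  and weave_Nil [simp]: "weave a [] js = []"
  by (simp_all add: weave_def)

abbreviation artanh_pow :: "nat \<Rightarrow> form list" where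
  "artanh_pow n \<equiv> replicate n Artanh"

lemma last_append_artanh_pow: "vs = [] \<or> last vs \<noteq> Log \<Longrightarrow> vs @ artanh_pow p = [] \<or> last (vs @ artanh_pow p) \<noteq> Log"
  by (cases p) (auto simp: last_append)

text \<open>
  These functions are the divided powers of \<open>hyperlog [Artanh]\<close>.
\<close>

lemma hyperlog_artanh_pow_mult:
  assumes "0 \<le> x" "x < 1"
  shows "hyperlog (artanh_pow m) x * hyperlog (artanh_pow p) x
    = real ((m + p) choose p) * hyperlog (artanh_pow (m + p)) x"
  using assms
proof (induction "m + p" arbitrary: m p x)
  case (Suc n)
  show ?case
  proof (cases "m = 0 \<or> p = 0")
    case False
    then obtain m' p' where mp: "m = Suc m'" "p = Suc p'"
      by (metis not0_implies_Suc)
    have n: "n = m' + Suc p'" "n = Suc m' + p'"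
      using Suc(2) mp by auto
    let ?h = "\<lambda>n. hyperlog (artanh_pow n)"
    have D: "(?h (Suc k) has_real_derivative density Artanh y * ?h k y) (at y)" if "0 < y" "y < 1" for k y
      using DERIV_hyperlog[OF that, of Artanh "artanh_pow k"] by (cases k) auto
    have "?h m x * ?h p x = real ((m + p) choose p) * ?h (Suc n) x"
    proof (rule eq_if_DERIV_eq[where x = x])
      fix y :: real assume y: "0 < y" "y < 1"
      have "((\<lambda>x. ?h m x * ?h p x) has_real_derivative
          density Artanh y * ?h m' y * ?h p y + density Artanh y * ?h p' y * ?h m y) (at y)"
        unfolding mp by (rule DERIV_mult[OF D[OF y] D[OF y]])
      moreover have "?h m' y * ?h p y = real (n choose p) * ?h n y"
        using Suc(1)[of m' p y] n mp y by simp
      moreover have "?h m y * ?h p' y = real (n choose p') * ?h n y"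
        using Suc(1)[of m p' y] n mp y by simp
      moreover have "(m + p) choose p = (n choose p) + (n choose p')"
        using n mp by simp
      ultimately show "((\<lambda>x. ?h m x * ?h p x) has_real_derivative
          real ((m + p) choose p) * (density Artanh y * ?h n y)) (at y)"
        by (simp only: of_nat_add) (simp only: mult_ac distrib_left distrib_right)
      show "((\<lambda>x. real ((m + p) choose p) * ?h (Suc n) x) has_real_derivative
          real ((m + p) choose p) * (density Artanh y * ?h n y)) (at y)"
        by (intro DERIV_cmult D y)
    qed (use Suc.prems mp in \<open>auto intro!: continuous_intros continuous_on_hyperlog\<close>)
    then show ?thesis
      by (simp only: Suc(2))
  qed auto
qed simp

text \<open>
  All words obtained by shuffling \<open>m\<close> further \<open>Artanh\<close> forms into \<open>vs @ artanh_pow p\<close>, where \<open>hd js - 1\<close>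
  of them come before \<open>vs\<close>. After the last letter of \<open>vs\<close> there are \<open>last js - 1\<close> new forms and \<open>p\<close> old
  ones, which can be mixed in \<open>(last js + p - 1) choose p\<close> ways.
\<close>

definition shuffle_sum :: "form list \<Rightarrow> nat \<Rightarrow> nat \<Rightarrow> real \<Rightarrow> real" where
  "shuffle_sum vs m p x = (\<Sum>js\<in>compositions (m + 1 + length vs) (length vs + 1).
     real ((last js + p - 1) choose p) *
       hyperlog (artanh_pow (hd js - 1) @ weave Artanh vs (tl js) @ artanh_pow p) x)"

lemma sum_compositions_eq_0:
  fixes f :: "nat list \<Rightarrow> real"
  assumes "w < d"
  shows "(\<Sum>js\<in>compositions w d. f js) = 0"
proof -
  have "length js \<le> sum_list js" if "\<forall>j\<in>set js. 1 \<le> j" for js :: "nat list"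
    using that by (induction js) auto
  then have "compositions w d = {}"
    using assms by (fastforce simp: compositions_def)
  then show ?thesis
    by simp
qed

lemma last_weave:
  assumes "last vs \<noteq> Log" "vs \<noteq> []" "length js = length vs"
  shows "last (weave Artanh vs js @ artanh_pow p) \<noteq> Log"
  using assms(3) assms(1,2)
proof (induction js vs rule: list_induct2)
  case (Cons j js v vs)
  show ?case
  proof (cases vs)
    case Nil
    then show ?thesis
      using Cons by (cases p; cases "j - 1") (auto simp: last_append)
  next
    case (Cons v' vs')
    then have "last (weave Artanh vs js @ artanh_pow p) \<noteq> Log"
      using Cons.IH Cons.prems Cons.hyps by simp
    moreover have "weave Artanh vs js \<noteq> []"
      using Cons.hyps Cons by (cases js) auto
    ultimately show ?thesis
      by (simp add: last_append split: if_splits)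
  qed
qed simp

text \<open>
  The outermost form of a word is removed: it is either \<open>v\<close> or a new \<open>Artanh\<close>.
\<close>

lemma DERIV_shuffle_sum:
  assumes vs: "last (v # vs) \<noteq> Log" and x: "0 < x" "x < 1"
  shows "(shuffle_sum (v # vs) m p has_real_derivative density v x * shuffle_sum vs m p x +
          density Artanh x * (if m = 0 then 0 else shuffle_sum (v # vs) (m - 1) p x)) (at x)"
proof -
  define d where "d = length vs + 1"
  define c where "c = (\<lambda>js. real ((last js + p - 1) choose p))"
  define w where "w = (\<lambda>vs js. artanh_pow (hd js - 1) @ weave Artanh vs (tl js) @ artanh_pow p)"
  have split: "shuffle_sum (v # vs) m p = (\<lambda>y. (\<Sum>js\<in>compositions (m + d) d. c js * hyperlog (v # w vs js) y) +
      (\<Sum>js\<in>compositions (m + d) (Suc d). c js * hyperlog (Artanh # w (v # vs) js) y))"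
  proof
    fix y
    have "shuffle_sum (v # vs) m p y = (\<Sum>js\<in>compositions (Suc (m + d)) (Suc d). c js * hyperlog (w (v # vs) js) y)"
      by (simp add: shuffle_sum_def d_def c_def w_def)
    also have "\<dots> = (\<Sum>js\<in>compositions (m + d) d. c (1 # js) * hyperlog (w (v # vs) (1 # js)) y) +
      (\<Sum>js\<in>compositions (m + d) (Suc d). c (Suc (hd js) # tl js) * hyperlog (w (v # vs) (Suc (hd js) # tl js)) y)"
      by (rule sum_compositions_Suc)
    also have "(\<Sum>js\<in>compositions (m + d) d. c (1 # js) * hyperlog (w (v # vs) (1 # js)) y)
        = (\<Sum>js\<in>compositions (m + d) d. c js * hyperlog (v # w vs js) y)"
      by (intro sum.cong refl) (auto simp: compositions_def d_def c_def w_def length_Suc_conv)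
    also have "(\<Sum>js\<in>compositions (m + d) (Suc d). c (Suc (hd js) # tl js) * hyperlog (w (v # vs) (Suc (hd js) # tl js)) y)
        = (\<Sum>js\<in>compositions (m + d) (Suc d). c js * hyperlog (Artanh # w (v # vs) js) y)"
    proof (intro sum.cong refl)
      fix js assume "js \<in> compositions (m + d) (Suc d)"
      then obtain i j js' where js: "js = Suc i # j # js'"
        by (auto simp: compositions_def d_def length_Suc_conv) (metis Suc_le_D)
      show "c (Suc (hd js) # tl js) * hyperlog (w (v # vs) (Suc (hd js) # tl js)) y
          = c js * hyperlog (Artanh # w (v # vs) js) y"
        by (simp add: js c_def w_def)
    qed
    finally show "shuffle_sum (v # vs) m p y = (\<Sum>js\<in>compositions (m + d) d. c js * hyperlog (v # w vs js) y) +
      (\<Sum>js\<in>compositions (m + d) (Suc d). c js * hyperlog (Artanh # w (v # vs) js) y)" .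
  qed
  have D1: "(hyperlog (v # w vs js) has_real_derivative density v x * hyperlog (w vs js) x) (at x)"
    if "js \<in> compositions (m + d) d" for js
  proof (rule DERIV_hyperlog[OF x])
    have len: "length (tl js) = length vs"
      using that by (simp add: compositions_def d_def)
    show "last (v # w vs js) \<noteq> Log"
    proof (cases "vs = []")
      case True
      then show ?thesis
        using vs by (cases p; cases "hd js - 1") (auto simp: w_def last_append)
    next
      case False
      have "last (weave Artanh vs (tl js) @ artanh_pow p) \<noteq> Log"
        using last_weave[of vs "tl js" p] False vs len by simp
      moreover have "weave Artanh vs (tl js) \<noteq> []"
        using False len by (cases vs; cases "tl js") auto
      ultimately show ?thesis
        by (simp add: w_def)
    qed
  qed
  have D2: "(hyperlog (Artanh # w (v # vs) js) has_real_derivative density Artanh x * hyperlog (w (v # vs) js) x) (at x)"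
    if "js \<in> compositions (m + d) (Suc d)" for js
  proof (rule DERIV_hyperlog[OF x])
    have len: "length (tl js) = length (v # vs)"
      using that by (simp add: compositions_def d_def)
    have "last (weave Artanh (v # vs) (tl js) @ artanh_pow p) \<noteq> Log"
      using last_weave[of "v # vs" "tl js" p] vs len by simp
    moreover have "weave Artanh (v # vs) (tl js) @ artanh_pow p \<noteq> []"
      using len by (cases "tl js") auto
    ultimately show "last (Artanh # w (v # vs) js) \<noteq> Log"
      by (simp add: w_def)
  qed
  have "(shuffle_sum (v # vs) m p has_real_derivative
      (\<Sum>js\<in>compositions (m + d) d. c js * (density v x * hyperlog (w vs js) x)) +
      (\<Sum>js\<in>compositions (m + d) (Suc d). c js * (density Artanh x * hyperlog (w (v # vs) js) x))) (at x)"
    unfolding split by (intro DERIV_add DERIV_sum DERIV_cmult D1 D2)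
  moreover have "(\<Sum>js\<in>compositions (m + d) d. c js * (density v x * hyperlog (w vs js) x)) = density v x * shuffle_sum vs m p x"
    unfolding shuffle_sum_def d_def c_def w_def sum_distrib_left
    by (intro sum.cong) (auto simp: mult_ac)
  moreover have "(\<Sum>js\<in>compositions (m + d) (Suc d). c js * (density Artanh x * hyperlog (w (v # vs) js) x))
      = density Artanh x * (if m = 0 then 0 else shuffle_sum (v # vs) (m - 1) p x)"
  proof -
    have "(\<Sum>js\<in>compositions (m + d) (Suc d). c js * (density Artanh x * hyperlog (w (v # vs) js) x))
        = density Artanh x * (\<Sum>js\<in>compositions (m + d) (Suc d). c js * hyperlog (w (v # vs) js) x)"
      by (simp only: sum_distrib_left mult.left_commute)
    also have "(\<Sum>js\<in>compositions (m + d) (Suc d). c js * hyperlog (w (v # vs) js) x)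
        = (if m = 0 then 0 else shuffle_sum (v # vs) (m - 1) p x)"
      by (cases m) (auto simp: sum_compositions_eq_0 shuffle_sum_def d_def c_def w_def)
    finally show ?thesis .
  qed
  ultimately show ?thesis
    by (simp only:)
qed

lemma continuous_on_shuffle_sum: "x < 1 \<Longrightarrow> continuous_on {0..x} (shuffle_sum vs m p)"
  unfolding shuffle_sum_def by (intro continuous_intros continuous_on_hyperlog)

lemma hyperlog_at_0: "w \<noteq> [] \<Longrightarrow> hyperlog w 0 = 0"
  by (cases w) auto

lemma shuffle_sum_at_0: "shuffle_sum (v # vs) m p 0 = 0"
proof -
  have "hyperlog (artanh_pow (hd js - 1) @ weave Artanh (v # vs) (tl js) @ artanh_pow p) 0 = 0"
    if "length js = Suc (Suc (length vs))" for js
  proof -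
    have "weave Artanh (v # vs) (tl js) \<noteq> []"
      using that by (auto simp: length_Suc_conv)
    then show ?thesis
      by (intro hyperlog_at_0) simp
  qed
  then show ?thesis
    unfolding shuffle_sum_def by (intro sum.neutral) (auto simp: compositions_def)
qed

lemma compositions_1: "compositions (Suc w) (Suc 0) = {[Suc w]}"
  by (auto simp: compositions_def length_Suc_conv)

text \<open>
  The shuffle product formula for a power of the logarithm: by the product rule, the right hand
  side satisfies the recursive differential equation of \<open>DERIV_shuffle_sum\<close>.
\<close>

theorem shuffle_sum_eq:
  assumes "vs = [] \<or> last vs \<noteq> Log" "0 \<le> x" "x < 1"
  shows "shuffle_sum vs m p x = hyperlog (artanh_pow m) x * hyperlog (vs @ artanh_pow p) x"
  using assms
proof (induction vs arbitrary: m x)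
  case Nil
  have "shuffle_sum [] m p x = real ((m + p) choose p) * hyperlog (artanh_pow (m + p)) x"
    by (simp add: shuffle_sum_def compositions_1 replicate_add)
  then show ?case
    using hyperlog_artanh_pow_mult[of x m p] Nil by simp
next
  case (Cons v vs)
  have IH: "shuffle_sum vs m p x = hyperlog (artanh_pow m) x * hyperlog (vs @ artanh_pow p) x"
    if "0 \<le> x" "x < 1" for m x
    using Cons.IH[of x m] Cons.prems(1) that by (cases vs) auto
  have v: "last (v # vs) \<noteq> Log"
    using Cons.prems by simp
  have DV: "(hyperlog ((v # vs) @ artanh_pow p) has_real_derivative density v y * hyperlog (vs @ artanh_pow p) y) (at y)"
    if "0 < y" "y < 1" for y
    using DERIV_hyperlog[OF that, of v "vs @ artanh_pow p"] last_append_artanh_pow[of "v # vs" p] v by simp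
  show ?case
    using Cons.prems(2,3)
  proof (induction m arbitrary: x)
    case 0
    show ?case
    proof (rule eq_if_DERIV_eq[where x = x])
      fix y :: real assume y: "0 < y" "y < 1"
      show "(shuffle_sum (v # vs) 0 p has_real_derivative density v y * hyperlog (vs @ artanh_pow p) y) (at y)"
        using DERIV_shuffle_sum[OF v y, of 0 p] IH[of y 0] y by simp
      show "((\<lambda>x. hyperlog (artanh_pow 0) x * hyperlog ((v # vs) @ artanh_pow p) x)
          has_real_derivative density v y * hyperlog (vs @ artanh_pow p) y) (at y)"
        using DV[OF y] by simp
    qed (use 0 in \<open>auto simp: shuffle_sum_at_0 intro!: continuous_intros continuous_on_hyperlog continuous_on_shuffle_sum\<close>)
  next
    case (Suc m)
    show ?case
    proof (rule eq_if_DERIV_eq[where x = x])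
      fix y :: real assume y: "0 < y" "y < 1"
      let ?d = "density v y * (hyperlog (artanh_pow (Suc m)) y * hyperlog (vs @ artanh_pow p) y) +
          density Artanh y * (hyperlog (artanh_pow m) y * hyperlog ((v # vs) @ artanh_pow p) y)"
      show "(shuffle_sum (v # vs) (Suc m) p has_real_derivative ?d) (at y)"
        using DERIV_shuffle_sum[OF v y, of "Suc m" p] IH[of y "Suc m"] Suc.IH[of y] y by simp
      have "(hyperlog (artanh_pow (Suc m)) has_real_derivative density Artanh y * hyperlog (artanh_pow m) y) (at y)"
        using DERIV_hyperlog[OF y, of Artanh "artanh_pow m"] by (cases m) auto
      from DERIV_mult[OF this DV[OF y]]
      show "((\<lambda>x. hyperlog (artanh_pow (Suc m)) x * hyperlog ((v # vs) @ artanh_pow p) x)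
          has_real_derivative ?d) (at y)"
        by (simp only: mult_ac add_ac)
    qed (use Suc.prems in \<open>auto simp: shuffle_sum_at_0 intro!: continuous_intros continuous_on_hyperlog continuous_on_shuffle_sum\<close>)
  qed
qed

section \<open>Telescoping over the cuts of a word\<close>

text \<open>
  This is the integral of \<open>density (hd ws)\<close> times \<open>shuffle_sum (tl ws) m p\<close>.
\<close>

definition woven_sum :: "form list \<Rightarrow> nat \<Rightarrow> nat \<Rightarrow> real \<Rightarrow> real" where
  "woven_sum ws m p x = (\<Sum>js\<in>compositions (m + length ws) (length ws).
     real ((last js + p - 1) choose p) * hyperlog (weave Artanh ws js @ artanh_pow p) x)"

lemma weave_not_Nil: "vs \<noteq> [] \<Longrightarrow> length js = length vs \<Longrightarrow> weave a vs js \<noteq> []"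
  by (cases vs; cases js) auto

lemma DERIV_woven_sum:
  assumes ws: "ws \<noteq> []" "last ws \<noteq> Log" and x: "0 < x" "x < 1"
  shows "(woven_sum ws m p has_real_derivative
     density (hd ws) x * (hyperlog (artanh_pow m) x * hyperlog (tl ws @ artanh_pow p) x)) (at x)"
proof -
  obtain v vs where ws_eq: "ws = v # vs"
    using ws by (cases ws) auto
  let ?c = "\<lambda>js. real ((last js + p - 1) choose p)"
  let ?u = "\<lambda>js. artanh_pow (hd js - 1) @ weave Artanh vs (tl js) @ artanh_pow p"
  have "(woven_sum ws m p has_real_derivative
      (\<Sum>js\<in>compositions (m + length ws) (length ws). ?c js * (density v x * hyperlog (?u js) x))) (at x)"
    unfolding woven_sum_def
  proof (intro DERIV_sum DERIV_cmult)
    fix js assume "js \<in> compositions (m + length ws) (length ws)"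
    then have len: "length js = length ws"
      by (simp add: compositions_def)
    then obtain j js' where js: "js = j # js'"
      by (cases js) (auto simp: ws_eq)
    have w: "weave Artanh ws js @ artanh_pow p = v # ?u js"
      by (simp add: ws_eq js)
    have "last (v # ?u js) \<noteq> Log"
      using last_weave[OF ws(2,1) len, of p] unfolding w .
    then show "(hyperlog (weave Artanh ws js @ artanh_pow p) has_real_derivative density v x * hyperlog (?u js) x) (at x)"
      unfolding w by (rule DERIV_hyperlog[OF x])
  qed
  also have "(\<Sum>js\<in>compositions (m + length ws) (length ws). ?c js * (density v x * hyperlog (?u js) x))
      = density v x * shuffle_sum vs m p x"
    unfolding shuffle_sum_def sum_distrib_left by (simp add: ws_eq mult.left_commute)
  also have "shuffle_sum vs m p x = hyperlog (artanh_pow m) x * hyperlog (vs @ artanh_pow p) x"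
    using ws x by (intro shuffle_sum_eq) (auto simp: ws_eq split: if_splits)
  finally show ?thesis
    by (simp add: ws_eq)
qed

lemma woven_sum_at_0: "ws \<noteq> [] \<Longrightarrow> woven_sum ws m p 0 = 0"
  unfolding woven_sum_def
  by (intro sum.neutral) (auto simp: compositions_def hyperlog_at_0 weave_not_Nil)

lemma continuous_on_woven_sum: "x < 1 \<Longrightarrow> continuous_on {0..x} (woven_sum ws m p)"
  unfolding woven_sum_def by (intro continuous_intros continuous_on_hyperlog)

lemma sum_alternating_telescope:
  fixes p :: "nat \<Rightarrow> real"
  shows "(\<Sum>a = 1..K. (-1) ^ a * (p (a - 1) + p a)) = (-1) ^ K * p K - p 0"
  by (induction K) (auto simp: algebra_simps)

lemma take_append_last: "length xs = Suc n \<Longrightarrow> take n xs @ [xs ! n] = xs"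
  using take_Suc_conv_app_nth[of n xs] by simp

text \<open>
  With \<open>q a\<close> the term in which the letter \<open>W ! a\<close> has been removed, the cut at \<open>a\<close> has the derivative
  \<open>q (a - 1) + q a\<close>: the letters on both sides of the cut are the outermost ones of their factors.
  The alternating sum telescopes to \<open>q 0\<close> and \<open>q K\<close>, the derivatives of the two woven sums.
\<close>

theorem alternating_cuts_eq:
  assumes W: "length W = Suc K" "hd W \<noteq> Log" "last W \<noteq> Log" and x: "0 \<le> x" "x < 1"
  shows "(\<Sum>a = 1..K. (-1) ^ a *
            (hyperlog (rev (take a W) @ artanh_pow p) x * hyperlog (drop a W @ artanh_pow m) x))
       = (-1) ^ K * woven_sum (rev W) m p x - woven_sum W p m x"
proof (rule eq_if_DERIV_eq[OF x])
  define F where "F = (\<lambda>a. hyperlog (rev (take a W) @ artanh_pow p))"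
  define G where "G = (\<lambda>a. hyperlog (drop a W @ artanh_pow m))"
  define q where "q = (\<lambda>a y. density (W ! a) y * (F a y * G (Suc a) y))"
  have ne: "W \<noteq> []"
    using W(1) by auto
  fix y :: real assume y: "0 < y" "y < 1"
  have DF: "(F (Suc a) has_real_derivative density (W ! a) y * F a y) (at y)" if "a \<le> K" for a
  proof -
    have eq: "rev (take (Suc a) W) @ artanh_pow p = W ! a # rev (take a W) @ artanh_pow p"
      using that W by (simp add: take_Suc_conv_app_nth)
    have "last (rev (take (Suc a) W)) \<noteq> Log"
      using W ne by (cases W) auto
    then have "last (rev (take (Suc a) W) @ artanh_pow p) \<noteq> Log"
      using last_append_artanh_pow[of "rev (take (Suc a) W)" p] ne by auto
    then show ?thesis
      unfolding F_def eq by (intro DERIV_hyperlog y)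
  qed
  have DG: "(G a has_real_derivative density (W ! a) y * G (Suc a) y) (at y)" if "a \<le> K" for a
  proof -
    have eq: "drop a W @ artanh_pow m = W ! a # drop (Suc a) W @ artanh_pow m"
      using that W by (simp add: Cons_nth_drop_Suc[symmetric])
    have "last (drop a W @ artanh_pow m) \<noteq> Log"
      using last_append_artanh_pow[of "drop a W" m] that W by auto
    then show ?thesis
      unfolding G_def eq by (intro DERIV_hyperlog y)
  qed
  have cut: "((\<lambda>y. F a y * G a y) has_real_derivative q (a - 1) y + q a y) (at y)"
    if a_cut: "a \<in> {1..K}" for a
  proof -
    obtain b where a: "a = Suc b" "b \<le> K" "a \<le> K"
      using a_cut by (cases a) auto
    have "((\<lambda>y. F a y * G a y) has_real_derivative
        density (W ! b) y * F b y * G a y + density (W ! a) y * G (Suc a) y * F a y) (at y)"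
      using DERIV_mult[OF DF[OF a(2)] DG[OF a(3)]] by (simp add: a(1))
    then show ?thesis
      by (simp add: q_def a(1) mult_ac)
  qed
  have "((\<lambda>y. \<Sum>a = 1..K. (-1) ^ a * (F a y * G a y)) has_real_derivative
      (\<Sum>a = 1..K. (-1) ^ a * (q (a - 1) y + q a y))) (at y)"
    by (intro DERIV_sum DERIV_cmult cut)
  then show "((\<lambda>x. \<Sum>a = 1..K. (-1) ^ a *
            (hyperlog (rev (take a W) @ artanh_pow p) x * hyperlog (drop a W @ artanh_pow m) x))
      has_real_derivative (-1) ^ K * q K y - q 0 y) (at y)"
    unfolding F_def G_def sum_alternating_telescope[of "\<lambda>a. q a y"] .
  have "rev W = W ! K # rev (take K W)"
    using take_append_last[OF W(1)] unfolding rev_eq_Cons_iff rev_rev_ident by (rule sym)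
  then have "hd (rev W) = W ! K" "tl (rev W) = rev (take K W)"
    by (simp_all only: list.sel)
  then have "(woven_sum (rev W) m p has_real_derivative q K y) (at y)"
    using DERIV_woven_sum[of "rev W" y m p] ne W y by (simp add: last_rev q_def F_def G_def mult_ac)
  moreover have "(woven_sum W p m has_real_derivative q 0 y) (at y)"
    using DERIV_woven_sum[of W y p m] ne W y by (simp add: q_def F_def G_def hd_conv_nth drop_Suc)
  ultimately show "((\<lambda>x. (-1) ^ K * woven_sum (rev W) m p x - woven_sum W p m x)
      has_real_derivative (-1) ^ K * q K y - q 0 y) (at y)"
    by (intro DERIV_diff DERIV_cmult)
next
  have "hyperlog (rev (take a W) @ artanh_pow p) 0 = 0" if "a \<in> {1..K}" for a
    using that W by (intro hyperlog_at_0) auto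
  moreover have "W \<noteq> []"
    using W by auto
  ultimately show "(\<Sum>a = 1..K. (-1) ^ a *
            (hyperlog (rev (take a W) @ artanh_pow p) 0 * hyperlog (drop a W @ artanh_pow m) 0))
       = (-1) ^ K * woven_sum (rev W) m p 0 - woven_sum W p m 0"
    by (simp add: woven_sum_at_0)
qed (auto intro!: continuous_intros continuous_on_hyperlog continuous_on_woven_sum)

section \<open>The words of the signed sequences\<close>

text \<open>
  In the word of a \<open>T\<close>-value whose last entry alone is barred, every entry contributes the sign
  \<open>-1\<close>, hence such a block, innermost form first.
\<close>

definition log_block :: "nat \<Rightarrow> form list" where
  "log_block k = Arctan # replicate (k - 1) Log"

definition log_word :: "nat list \<Rightarrow> form list" where
  "log_word ks = concat (map log_block ks) @ [Arctan]"

definition artanh_word :: "nat list \<Rightarrow> form list" where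
  "artanh_word ks = map dual (log_word ks)"

lemma dual_dual [simp]: "dual (dual a) = a"
  by (cases a) auto

lemma artanh_word_Nil: "artanh_word [] = [Arctan]"
  and artanh_word_Cons: "artanh_word (c # cs) = (Arctan # artanh_pow (c - 1)) @ artanh_word cs"
  by (simp_all add: artanh_word_def log_word_def log_block_def)

text \<open>
  The word begins and ends with \<open>Arctan\<close>, so it can be cut into blocks from either end. This is why
  \<open>ks\<close> and its reversal play symmetric parts in the identity.
\<close>

lemma concat_log_block_shift:
  "concat (map log_block ks) @ [Arctan] = Arctan # concat (map (\<lambda>k. rev (log_block k)) ks)"
proof (induction ks)
  case (Cons k ks)
  then show ?case
    by (simp add: log_block_def)
qed simp

lemma log_word_rev: "rev (log_word ks) = log_word (rev ks)"
proof -
  have "rev (log_word ks) = Arctan # concat (map (\<lambda>k. rev (log_block k)) (rev ks))"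
    by (simp add: log_word_def rev_concat rev_map o_def)
  then show ?thesis
    by (simp add: log_word_def concat_log_block_shift)
qed

lemma length_concat_log_block:
  "\<forall>k\<in>set ks. 1 \<le> k \<Longrightarrow> length (concat (map log_block ks)) = sum_list ks"
  by (induction ks) (auto simp: log_block_def)

lemma map_dual_weave: "map dual (weave a vs js) = weave (dual a) (map dual vs) js"
  by (simp add: weave_def map_concat zip_map1 o_def case_prod_unfold)

lemma weave_append:
  "length us = length is \<Longrightarrow> weave a (us @ vs) (is @ js) = weave a us is @ weave a vs js"
  by (simp add: weave_def)

lemma prod_list_map_rev:
  fixes f :: "'a \<Rightarrow> int"
  shows "prod_list (map f (rev xs)) = prod_list (map f xs)"
  by (induction xs) auto

lemma outer_word_append:
  "outer_word \<epsilon> (s @ s') = outer_word \<epsilon> s @ outer_word (\<epsilon> * prod_list (map snd s)) s'"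
  by (induction s arbitrary: \<epsilon>) (auto simp: mult.assoc)

lemma outer_word_plain:
  "outer_word \<tau> (map plain ks) = concat (map (\<lambda>k. replicate (k - 1) Log @ [pole_form \<tau>]) ks)"
  by (induction ks) (auto simp: plain_def)

lemma prod_snd_plain [simp]: "prod_list (map snd (map plain ks)) = 1"
  by (induction ks) (auto simp: plain_def)

lemma beta_snoc: "beta (a # as @ [b]) = bar a # map plain as @ [bar b]"
  by (cases as) (auto simp: butlast_append)

lemma weave_replicate:
  "length js = n \<Longrightarrow> weave a (replicate n v) js = concat (map (\<lambda>j. v # replicate (j - 1) a) js)"
  by (induction js arbitrary: n) auto

text \<open>
  With sign \<open>-1\<close> coming from outside, the last bar of a block flips the sign to \<open>+1\<close> and the first bar
  flips it back. So the first entry contributes \<open>Arctan\<close>, the other ones \<open>Artanh\<close>, and the entries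
  further in see the sign \<open>-1\<close> again. A block of length 1 has no bar and fits the same pattern.
\<close>

lemma outer_word_beta:
  assumes "js \<noteq> []"
  shows "outer_word (-1) (rev (beta js)) = rev (weave Log (Arctan # artanh_pow (length js - 1)) js)"
    and "prod_list (map snd (beta js)) = 1"
proof -
  obtain a as where js: "js = a # as"
    using assms by (cases js) auto
  have "outer_word (-1) (rev (beta js)) = rev (weave Log (Arctan # artanh_pow (length js - 1)) js)
      \<and> prod_list (map snd (beta js)) = 1"
  proof (cases as rule: rev_cases)
    case Nil
    then show ?thesis
      by (simp add: js plain_def pole_form_def)
  next
    case (snoc bs b)
    have "rev (weave Log (artanh_pow (length (bs @ [b]))) (bs @ [b]))
        = concat (map (\<lambda>j. replicate (j - 1) Log @ [Artanh]) (b # rev bs))"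
      by (subst weave_replicate[OF refl]) (simp add: rev_concat rev_map o_def)
    then have "rev (weave Log (Arctan # artanh_pow (length js - 1)) js)
        = concat (map (\<lambda>j. replicate (j - 1) Log @ [Artanh]) (b # rev bs)) @ replicate (a - 1) Log @ [Arctan]"
      by (simp add: js snoc del: concat.simps list.map)
    moreover have "outer_word (-1) (rev (beta js))
        = replicate (b - 1) Log @ Artanh # outer_word 1 (map plain (rev bs) @ [bar a])"
      by (simp add: js snoc beta_snoc rev_map bar_def pole_form_def)
    moreover have "outer_word 1 (map plain (rev bs) @ [bar a])
        = concat (map (\<lambda>j. replicate (j - 1) Log @ [Artanh]) (rev bs)) @ replicate (a - 1) Log @ [Arctan]"
      unfolding outer_word_append prod_snd_plain outer_word_plain by (simp add: bar_def pole_form_def)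
    moreover have "prod_list (map snd (beta js)) = 1"
      using prod_snd_plain[of bs] by (simp add: js snoc beta_snoc bar_def del: prod_snd_plain)
    ultimately show ?thesis
      by simp
  qed
  then show "outer_word (-1) (rev (beta js)) = rev (weave Log (Arctan # artanh_pow (length js - 1)) js)"
    "prod_list (map snd (beta js)) = 1"
    by auto
qed

text \<open>
  The entry \<open>j\<close> stands for the final barred entry, which contributes the last letter \<open>Arctan\<close> of
  \<open>artanh_word cs\<close> and supplies the sign \<open>-1\<close> to the blocks.
\<close>

lemma outer_word_beta_blocks:
  assumes "\<forall>c\<in>set cs. 1 \<le> c" "length js = sum_list cs"
  shows "rev (weave Log (artanh_word cs) (js @ [j])) = replicate (j - 1) Log @ Arctan # outer_word (-1) (rev (beta_blocks cs js))
    \<and> prod_list (map snd (beta_blocks cs js)) = 1"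
  using assms
proof (induction cs arbitrary: js)
  case Nil
  then show ?case
    by (simp add: artanh_word_Nil)
next
  case (Cons c cs)
  define as bs where "as = take c js" and "bs = drop c js"
  have js: "js = as @ bs" and len: "length as = c" "length bs = sum_list cs"
    using Cons.prems by (auto simp: as_def bs_def)
  have c: "1 \<le> c" "as \<noteq> []"
    using Cons.prems len by auto
  have IH: "rev (weave Log (artanh_word cs) (bs @ [j])) = replicate (j - 1) Log @ Arctan # outer_word (-1) (rev (beta_blocks cs bs))"
    "prod_list (map snd (beta_blocks cs bs)) = 1"
    using Cons.IH[of bs] Cons.prems len by auto
  have "weave Log (artanh_word (c # cs)) (js @ [j]) = weave Log (Arctan # artanh_pow (c - 1)) as @ weave Log (artanh_word cs) (bs @ [j])"
    unfolding artanh_word_Cons js append_assoc using c len by (intro weave_append) auto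
  moreover have "beta_blocks (c # cs) js = beta as @ beta_blocks cs bs"
    by (simp add: as_def bs_def)
  moreover have "prod_list (map snd (rev (beta_blocks cs bs))) = 1"
    using IH(2) by (simp add: prod_list_map_rev)
  ultimately show ?case
    using IH outer_word_beta[OF c(2)] len by (simp add: outer_word_append)
qed

lemma outer_word_rev_P: "outer_word (-1) (rev (P q)) = artanh_pow q"
proof (cases q)
  case (Suc n)
  have "outer_word 1 (map plain (replicate n 1)) = artanh_pow n"
    unfolding outer_word_plain by (induction n) (auto simp: pole_form_def)
  then show ?thesis
    by (simp add: Suc P_def bar_def pole_form_def)
qed (simp add: P_def)

lemma outer_word_bar: "outer_word 1 (bar k # s) = replicate (k - 1) Log @ Arctan # outer_word (-1) s"
  by (simp add: bar_def pole_form_def)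

lemma valid_seq_append [simp]: "valid_seq (s @ s') \<longleftrightarrow> valid_seq s \<and> valid_seq s'"
  by (auto simp: valid_seq_def)

lemma valid_seq_bar [simp]: "valid_seq (bar k # s) \<longleftrightarrow> 1 \<le> k \<and> valid_seq s"
  and valid_seq_Nil [simp]: "valid_seq []"
  by (auto simp: valid_seq_def bar_def)

lemma valid_seq_map_plain [simp]: "valid_seq (map plain ks) \<longleftrightarrow> (\<forall>k\<in>set ks. 1 \<le> k)"
  by (auto simp: valid_seq_def plain_def)

lemma valid_seq_P: "valid_seq (P q)"
proof -
  have "replicate (q - 1) (plain 1) = map plain (replicate (q - 1) 1)"
    by simp
  then show ?thesis
    unfolding P_def by (simp del: map_replicate)
qed

lemma valid_seq_beta:
  assumes "\<forall>j\<in>set js. 1 \<le> j"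
  shows "valid_seq (beta js)"
proof (cases js)
  case (Cons a as)
  show ?thesis
  proof (cases as rule: rev_cases)
    case Nil
    then show ?thesis
      using assms by (simp add: Cons valid_seq_def plain_def)
  next
    case (snoc bs b)
    then show ?thesis
      using assms by (simp add: Cons beta_snoc)
  qed
qed simp

lemma valid_seq_beta_blocks: "\<forall>j\<in>set js. 1 \<le> j \<Longrightarrow> valid_seq (beta_blocks cs js)"
  by (induction cs arbitrary: js) (auto intro!: valid_seq_beta dest: in_set_takeD in_set_dropD)

lemma word_sign_weave_Log: "length js = length vs \<Longrightarrow> word_sign (weave Log vs js) = word_sign vs"
  by (induction js vs rule: list_induct2) auto

lemma word_sign_artanh_word: "word_sign (artanh_word cs) = (-1) ^ (length cs + 1)"
  by (induction cs) (auto simp: artanh_word_Nil artanh_word_Cons)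

lemma length_log_word: "\<forall>c\<in>set cs. 1 \<le> c \<Longrightarrow> length (log_word cs) = Suc (sum_list cs)"
  by (simp add: log_word_def length_concat_log_block del: length_concat)

section \<open>Both sides of the identity as limits\<close>

text \<open>
  The word of the \<open>T\<close>-value has filler \<open>Log\<close> and letters \<open>artanh_word cs\<close>; duality exchanges the two
  kinds of forms.
\<close>

lemma endvalue_weave:
  assumes cs: "\<forall>c\<in>set cs. 1 \<le> c" and js: "length js = Suc (sum_list cs)" "\<forall>j\<in>set js. 1 \<le> j"
  defines "K \<equiv> sum_list cs"
  shows "endvalue (weave Artanh (log_word cs) js @ artanh_pow p)
    ((-1) ^ (length cs + 1) * T (beta_blocks cs (take K js) @ [bar (js ! K + p)]))"
proof -
  define s j where "s = beta_blocks cs (take K js)" and "j = js ! K"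
  have js_eq: "js = take K js @ [j]"
    using take_append_last[OF js(1)] unfolding K_def j_def by (rule sym)
  have j: "1 \<le> j"
    using js by (simp add: j_def K_def)
  have s: "valid_seq s"
    unfolding s_def using js by (intro valid_seq_beta_blocks) (auto dest: in_set_takeD)
  define U where "U = weave Log (artanh_word cs) js @ replicate p Log"
  have len: "length js = length (artanh_word cs)"
    using js length_log_word[OF cs] by (simp add: artanh_word_def)
  have "rev (weave Log (artanh_word cs) (take K js @ [j])) = replicate (j - 1) Log @ Arctan # outer_word (-1) (rev s)"
    unfolding s_def using outer_word_beta_blocks[OF cs, of "take K js" j] js by (simp add: K_def)
  then have "rev U = replicate p Log @ replicate (j - 1) Log @ Arctan # outer_word (-1) (rev s)"
    unfolding U_def js_eq[symmetric] by simp
  also have "\<dots> = outer_word 1 (bar (j + p) # rev s)"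
    using j by (simp add: outer_word_bar add.commute flip: replicate_add append_assoc)
  finally have rev_U: "rev U = outer_word 1 (bar (j + p) # rev s)" .
  have "endvalue (rev U) (word_sign (rev U) * T (s @ [bar (j + p)]))"
    unfolding rev_U using s j by (intro endvalue_T) auto
  also have "word_sign (rev U) = (-1) ^ (length cs + 1)"
    using len by (simp add: U_def word_sign_weave_Log word_sign_artanh_word)
  finally have "endvalue (map dual U) ((-1) ^ (length cs + 1) * T (s @ [bar (j + p)]))"
  proof (rule endvalue_dual[rotated 3])
    show "U \<noteq> []"
      using rev_U by (auto simp: outer_word_bar)
    then have "last U = hd (rev U)"
      by (simp add: hd_rev)
    then show "last U \<noteq> Artanh"
      unfolding rev_U outer_word_bar by (cases "j + p - 1") auto
    obtain vs where "artanh_word cs = Arctan # vs"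
      unfolding artanh_word_def log_word_def concat_log_block_shift by simp
    moreover obtain i "is" where "js = i # is"
      using js(1) by (cases js) auto
    ultimately show "hd U \<noteq> Log"
      by (simp add: U_def)
  qed
  also have "map dual U = weave Artanh (log_word cs) js @ artanh_pow p"
    by (simp add: U_def map_dual_weave artanh_word_def o_def)
  finally show ?thesis
    by (simp add: s_def j_def)
qed

lemma tendsto_woven_sum:
  assumes cs: "\<forall>c\<in>set cs. 1 \<le> c"
  defines "K \<equiv> sum_list cs"
  shows "(woven_sum (log_word cs) m p \<longlongrightarrow> (-1) ^ (length cs + 1) *
     (\<Sum>js\<in>compositions (m + 1 + K) (K + 1). real ((js ! K + p - 1) choose p) *
        T (beta_blocks cs (take K js) @ [bar (js ! K + p)]))) (at_left 1)"
proof -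
  have "((\<lambda>x. \<Sum>js\<in>compositions (m + 1 + K) (K + 1). real ((js ! K + p - 1) choose p) *
        hyperlog (weave Artanh (log_word cs) js @ artanh_pow p) x) \<longlongrightarrow>
      (\<Sum>js\<in>compositions (m + 1 + K) (K + 1). real ((js ! K + p - 1) choose p) *
        ((-1) ^ (length cs + 1) * T (beta_blocks cs (take K js) @ [bar (js ! K + p)])))) (at_left 1)"
  proof (intro tendsto_sum tendsto_mult tendsto_const)
    fix js assume "js \<in> compositions (m + 1 + K) (K + 1)"
    then show "(hyperlog (weave Artanh (log_word cs) js @ artanh_pow p) \<longlongrightarrow>
        (-1) ^ (length cs + 1) * T (beta_blocks cs (take K js) @ [bar (js ! K + p)])) (at_left 1)"
      using endvalue_weave[OF cs, of js p] by (simp add: endvalue_def compositions_def K_def)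
  qed
  moreover have "woven_sum (log_word cs) m p = (\<lambda>x. \<Sum>js\<in>compositions (m + 1 + K) (K + 1).
      real ((js ! K + p - 1) choose p) * hyperlog (weave Artanh (log_word cs) js @ artanh_pow p) x)"
  proof -
    have "last js = js ! K" if "js \<in> compositions (m + 1 + K) (K + 1)" for js
      using that by (subst last_conv_nth) (auto simp: compositions_def)
    then show ?thesis
      unfolding woven_sum_def length_log_word[OF cs] by (auto simp: K_def intro!: sum.cong)
  qed
  ultimately show ?thesis
    unfolding sum_distrib_left by (simp only: mult.left_commute)
qed

text \<open>
  Here all signs in the words are equal to \<open>-1\<close> up to the bar of \<open>P q\<close>, which flips them to \<open>+1\<close> for
  the innermost \<open>q\<close> entries; so no duality is involved.
\<close>

lemma endvalue_cut:
  assumes pre: "\<forall>k\<in>set pre. 1 \<le> k" and i: "1 \<le> i"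
  shows "endvalue (replicate (i - 1) Log @ Arctan # concat (map (\<lambda>k. rev (log_block k)) pre) @ artanh_pow q)
    ((-1) ^ (length pre + 1) * T (P q @ map plain (rev pre) @ [bar i]))"
proof -
  define s where "s = P q @ map plain (rev pre)"
  have w: "outer_word 1 (bar i # rev s)
      = replicate (i - 1) Log @ Arctan # concat (map (\<lambda>k. rev (log_block k)) pre) @ artanh_pow q"
    unfolding outer_word_bar s_def
    by (simp add: rev_map outer_word_append outer_word_plain outer_word_rev_P log_block_def pole_form_def
        del: map_map)
  have "word_sign (concat (map (\<lambda>k. rev (log_block k)) pre)) = (-1) ^ length pre"
    by (induction pre) (auto simp: log_block_def)
  then have "word_sign (outer_word 1 (bar i # rev s)) = (-1) ^ (length pre + 1)"
    unfolding w by simp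
  moreover have "valid_seq s"
    using pre by (simp add: s_def valid_seq_P)
  ultimately show ?thesis
    using endvalue_T[of s i] i unfolding w by (simp add: s_def)
qed

text \<open>
  The positions \<open>1, ..., K\<close> at which \<open>W\<close> can be cut are grouped by the block \<open>l\<close> that the prefix ends in;
  \<open>j - 1\<close> letters of that block are left to the suffix.
\<close>

lemma sum_over_blocks:
  fixes f :: "nat \<Rightarrow> real"
  shows "(\<Sum>a = 1..sum_list ks. f a) =
    (\<Sum>l = 1..length ks. \<Sum>j = 1..ks ! (l - 1). f (sum_list (take (l - 1) ks) + (ks ! (l - 1) - j + 1)))"
proof (induction ks rule: rev_induct)
  case (snoc k ks)
  define S where "S = sum_list ks"
  have "(\<Sum>a = 1..S + k. f a) = (\<Sum>a = 1..S. f a) + (\<Sum>a = S + 1..S + k. f a)"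
    by (rule sum.ub_add_nat) simp
  also have "(\<Sum>a = S + 1..S + k. f a) = (\<Sum>j = 1..k. f (S + (k - j + 1)))"
    by (rule sum.reindex_bij_witness[where i = "\<lambda>j. S + (k - j + 1)" and j = "\<lambda>a. S + k - a + 1"]) auto
  finally have "(\<Sum>a = 1..sum_list (ks @ [k]). f a)
      = (\<Sum>a = 1..sum_list ks. f a) + (\<Sum>j = 1..k. f (S + (k - j + 1)))"
    by (simp add: S_def)
  also have "(\<Sum>a = 1..sum_list ks. f a) = (\<Sum>l = 1..length ks. \<Sum>j = 1..(ks @ [k]) ! (l - 1).
      f (sum_list (take (l - 1) (ks @ [k])) + ((ks @ [k]) ! (l - 1) - j + 1)))"
    unfolding snoc.IH by (intro sum.cong refl) (auto simp: nth_append)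
  finally show ?case
    by (simp add: S_def)
qed simp

lemma cut_of_log_word:
  assumes ks: "\<forall>k\<in>set ks. 1 \<le> k" and l: "1 \<le> l" "l \<le> length ks" and j: "1 \<le> j" "j \<le> ks ! (l - 1)"
  defines "a \<equiv> sum_list (take (l - 1) ks) + (ks ! (l - 1) - j + 1)"
  shows "rev (take a (log_word ks)) = replicate (ks ! (l - 1) - j) Log @ Arctan #
            concat (map (\<lambda>k. rev (log_block k)) (rev (take (l - 1) ks)))"
    and "drop a (log_word ks) = replicate (j - 1) Log @ Arctan #
            concat (map (\<lambda>k. rev (log_block k)) (drop l ks))"
proof -
  define k where "k = ks ! (l - 1)"
  define pre where "pre = concat (map log_block (take (l - 1) ks))"
  have split: "ks = take (l - 1) ks @ k # drop l ks"
    using id_take_nth_drop[of "l - 1" ks] l by (simp add: k_def)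
  have "concat (map log_block ks) = pre @ log_block k @ concat (map log_block (drop l ks))"
    by (subst split) (simp add: pre_def)
  moreover have "log_block k = (Arctan # replicate (k - j) Log) @ replicate (j - 1) Log"
    using j by (simp add: log_block_def k_def flip: replicate_add)
  ultimately have W: "log_word ks = (pre @ Arctan # replicate (k - j) Log) @
      (replicate (j - 1) Log @ concat (map log_block (drop l ks)) @ [Arctan])"
    by (simp add: log_word_def)
  have "length pre = sum_list (take (l - 1) ks)"
    unfolding pre_def using ks by (intro length_concat_log_block) (auto dest: in_set_takeD)
  then have a: "a = length (pre @ Arctan # replicate (k - j) Log)"
    by (simp add: a_def k_def)
  have "take a (log_word ks) = pre @ Arctan # replicate (k - j) Log"
    unfolding W a by simp
  then show "rev (take a (log_word ks)) = replicate (ks ! (l - 1) - j) Log @ Arctan #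
            concat (map (\<lambda>k. rev (log_block k)) (rev (take (l - 1) ks)))"
    by (simp add: pre_def k_def rev_concat rev_map o_def)
  have "drop a (log_word ks) = replicate (j - 1) Log @ concat (map log_block (drop l ks)) @ [Arctan]"
    unfolding W a by simp
  then show "drop a (log_word ks) = replicate (j - 1) Log @ Arctan #
            concat (map (\<lambda>k. rev (log_block k)) (drop l ks))"
    by (simp only: concat_log_block_shift)
qed

lemma cancel_signs:
  fixes s e A B C :: real
  assumes "s * (e * A) - e * B = s * e * C" "e * e = 1" "s * s = 1"
  shows "A + - s * B = C"
proof -
  have "(s * e) * (s * (e * A) - e * B) = (s * e) * (s * e * C)"
    using assms(1) by (rule arg_cong)
  then have "(s * s) * (e * e) * A - s * (e * e) * B = (s * s) * (e * e) * C"
    by (simp add: algebra_simps)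
  then show ?thesis
    unfolding assms(2,3) by simp
qed

theorem theorem1p2p3:
  fixes ks :: "nat list" and m p :: nat
  assumes "ks \<noteq> []" and "\<forall>k\<in>set ks. 1 \<le> k"
  defines "r \<equiv> length ks" and "K \<equiv> sum_list ks"
  shows
    "(\<Sum>js\<in>compositions (m + 1 + K) (K + 1).
        real ((js ! K + p - 1) choose p)
          * T (beta_blocks (rev ks) (take K js) @ [bar (js ! K + p)]))
     + (-1) ^ (K + 1) *
       (\<Sum>js\<in>compositions (p + 1 + K) (K + 1).
          real ((js ! K + m - 1) choose m)
            * T (beta_blocks ks (take K js) @ [bar (js ! K + m)]))
     = (\<Sum>l = 1..r. (-1) ^ sum_list (drop l ks) *
         (\<Sum>j = 1..ks ! (l - 1). (-1) ^ (j - 1)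
            * T (P m @ map plain (rev (drop l ks)) @ [bar j])
            * T (P p @ map plain (take (l - 1) ks) @ [bar (ks ! (l - 1) - j + 1)])))"
    (is "?S1 + _ * ?S2 = ?R")
proof -
  note ks = assms(2)
  define W where "W = log_word ks"
  define e :: real where "e = (-1) ^ (r + 1)"
  define TA where "TA = (\<lambda>l j. T (P m @ map plain (rev (drop l ks)) @ [bar j]))"
  define TB where "TB = (\<lambda>l j. T (P p @ map plain (take (l - 1) ks) @ [bar (ks ! (l - 1) - j + 1)]))"
  define cut where "cut = (\<lambda>l j. sum_list (take (l - 1) ks) + (ks ! (l - 1) - j + 1))"
  define Phi where "Phi = (\<lambda>x. \<Sum>a = 1..K. (-1) ^ a *
      (hyperlog (rev (take a W) @ artanh_pow p) x * hyperlog (drop a W @ artanh_pow m) x))"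
  have "length W = Suc K"
    unfolding W_def K_def by (rule length_log_word[OF ks])
  moreover have "hd W = Arctan"
    unfolding W_def log_word_def concat_log_block_shift by simp
  moreover have "last W = Arctan"
    by (simp add: W_def log_word_def)
  ultimately have Phi_eq: "Phi x = (-1) ^ K * woven_sum (log_word (rev ks)) m p x - woven_sum W p m x"
    if "0 \<le> x" "x < 1" for x
    unfolding Phi_def using that by (subst alternating_cuts_eq) (auto simp: W_def log_word_rev)
  have "((\<lambda>x. (-1) ^ K * woven_sum (log_word (rev ks)) m p x - woven_sum W p m x)
      \<longlongrightarrow> (-1) ^ K * (e * ?S1) - e * ?S2) (at_left 1)"
    using tendsto_woven_sum[of "rev ks" m p] tendsto_woven_sum[of ks p m] ks
    by (intro tendsto_diff tendsto_mult tendsto_const) (simp_all add: W_def K_def r_def e_def sum_list_rev)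
  moreover have "\<forall>\<^sub>F x in at_left 1.
      (-1) ^ K * woven_sum (log_word (rev ks)) m p x - woven_sum W p m x = Phi x"
    using eventually_at_left_real[of 0 "1::real", simplified]
    by eventually_elim (simp add: Phi_eq)
  ultimately have lim1: "(Phi \<longlongrightarrow> (-1) ^ K * (e * ?S1) - e * ?S2) (at_left 1)"
    by (rule Lim_transform_eventually)
  have "((\<lambda>x. \<Sum>l = 1..r. \<Sum>j = 1..ks ! (l - 1). (-1) ^ cut l j *
      (hyperlog (rev (take (cut l j) W) @ artanh_pow p) x * hyperlog (drop (cut l j) W @ artanh_pow m) x))
      \<longlongrightarrow> (\<Sum>l = 1..r. \<Sum>j = 1..ks ! (l - 1). (-1) ^ cut l j *
          (((-1) ^ l * TB l j) * ((-1) ^ (r - l + 1) * TA l j)))) (at_left 1)"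
  proof (intro tendsto_sum tendsto_mult tendsto_const)
    fix l j assume "l \<in> {1..r}" "j \<in> {1..ks ! (l - 1)}"
    then have l: "1 \<le> l" "l \<le> length ks" and j: "1 \<le> j" "j \<le> ks ! (l - 1)"
      by (auto simp: r_def)
    note words = cut_of_log_word[OF ks l j, folded W_def cut_def]
    have "\<forall>k\<in>set (rev (take (l - 1) ks)). 1 \<le> k"
      using ks by (auto dest: in_set_takeD)
    from endvalue_cut[OF this, of "ks ! (l - 1) - j + 1" p]
    show "(hyperlog (rev (take (cut l j) W) @ artanh_pow p) \<longlongrightarrow> (-1) ^ l * TB l j) (at_left 1)"
      using l unfolding words cut_def by (simp add: endvalue_def TB_def)
    have "\<forall>k\<in>set (drop l ks). 1 \<le> k"
      using ks by (auto dest: in_set_dropD)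
    from endvalue_cut[OF this j(1), of m]
    show "(hyperlog (drop (cut l j) W @ artanh_pow m) \<longlongrightarrow> (-1) ^ (r - l + 1) * TA l j) (at_left 1)"
      unfolding words cut_def by (simp add: endvalue_def TA_def r_def)
  qed
  also have "(\<lambda>x. \<Sum>l = 1..r. \<Sum>j = 1..ks ! (l - 1). (-1) ^ cut l j *
      (hyperlog (rev (take (cut l j) W) @ artanh_pow p) x * hyperlog (drop (cut l j) W @ artanh_pow m) x)) = Phi"
    unfolding Phi_def K_def r_def cut_def by (subst sum_over_blocks) simp
  finally have lim2: "(Phi \<longlongrightarrow> (\<Sum>l = 1..r. \<Sum>j = 1..ks ! (l - 1). (-1) ^ cut l j *
          (((-1) ^ l * TB l j) * ((-1) ^ (r - l + 1) * TA l j)))) (at_left 1)" .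
  have "(\<Sum>l = 1..r. \<Sum>j = 1..ks ! (l - 1). (-1) ^ cut l j * (((-1) ^ l * TB l j) * ((-1) ^ (r - l + 1) * TA l j)))
      = (-1) ^ K * e * ?R"
    unfolding sum_distrib_left
  proof (intro sum.cong refl)
    fix l j assume "l \<in> {1..r}" "j \<in> {1..ks ! (l - 1)}"
    then have l: "1 \<le> l" "l \<le> length ks" and j: "1 \<le> j" "j \<le> ks ! (l - 1)"
      by (auto simp: r_def)
    have "sum_list (take (l - 1) ks @ ks ! (l - 1) # drop l ks) = K"
      using id_take_nth_drop[of "l - 1" ks] l by (simp add: K_def)
    then have K: "K = sum_list (take (l - 1) ks) + ks ! (l - 1) + sum_list (drop l ks)"
      by simp
    \<comment> \<open>The parity of the cut position yields the sign on the right hand side, relative to the cut at \<open>K\<close>.\<close>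
    have "even (cut l j + (K + sum_list (drop l ks) + (j - 1)))"
      using j unfolding K cut_def by presburger
    then have "(-1) ^ (cut l j + (K + sum_list (drop l ks) + (j - 1))) = (1 :: real)"
      by simp
    then have s1: "(-1) ^ cut l j = (-1) ^ K * ((-1) ^ sum_list (drop l ks) * (-1 :: real) ^ (j - 1))"
      by (auto simp: power_add minus_one_power_iff split: if_splits)
    have "(-1) ^ l * (-1) ^ (r - l + 1) = e"
      using l by (simp add: e_def r_def flip: power_add)
    then have "(-1) ^ cut l j * (((-1) ^ l * TB l j) * ((-1) ^ (r - l + 1) * TA l j)) = (-1) ^ cut l j * (e * (TA l j * TB l j))"
      by (simp only: mult_ac)
    then show "(-1) ^ cut l j * (((-1) ^ l * TB l j) * ((-1) ^ (r - l + 1) * TA l j))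
      = (-1) ^ K * e * ((-1) ^ sum_list (drop l ks) * ((-1) ^ (j - 1)
            * T (P m @ map plain (rev (drop l ks)) @ [bar j])
            * T (P p @ map plain (take (l - 1) ks) @ [bar (ks ! (l - 1) - j + 1)])))"
      unfolding s1 by (simp only: TA_def TB_def mult_ac)
  qed
  then have "(-1) ^ K * (e * ?S1) - e * ?S2 = (-1) ^ K * e * ?R"
    using tendsto_unique[OF _ lim1 lim2] by simp
  then have "?S1 + - ((-1) ^ K) * ?S2 = ?R"
    by (rule cancel_signs) (simp_all add: e_def flip: power_add)
  then show ?thesis
    by simp
qed

end
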